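(* Let $G$ be a topological group, let $X$ be a locally compact Hausdorff space and let $S\subseteq\Gamma(X)$ be a $\tau_{hco}$-closed inverse subsemigroup. Suppose $\theta:G\to(S,\tau_{hco})$ is a continuous unital premorphism. Then $\theta$ can be extended to a continuous semigroup homomorphism $\theta^*:\widetilde{G}_c^R\to(S,\tau_{hco})$; that is, there is a continuous semigroup homomorphism $\theta^*$ with $\theta^*(\{1,g\},g)=\theta(g)$ for all $g\in G$.
   Context: A unital premorphism $\theta:G\to S$ to an inverse monoid $S$ is a map with $\theta(1)=1$, $\theta(g^{-1})=\theta(g)^{-1}$ and $\theta(g)\theta(h)\le\theta(gh)$ for all $g,h\in G$, where $s\le t$ iff $s=et$ for some idempotent $e$. $\widetilde{G}_c^R=\{(A,g)\in K(G)\times G: \{1,g\}\subseteq A\}$ with product $(A,g)(B,h)=(A\cup gB,gh)$, and with the subspace topology from $K(G)\times G$. Here $K(G)$ is the set of compact subsets of $G$ with the Vietoris topology, having as a basis the sets $N(U_1,\dots,U_n)=\{K\in K(G): K\subseteq U_1\cup\dots\cup U_n,\ K\cap U_i\neq\emptyset\ \forall i\le n\}$, $U_i\subseteq G$ open. It is a topological inverse monoid. $\Gamma(X)$ is the inverse semigroup of all homeomorphisms $f:\mathrm{dom}(f)\to\mathrm{im}(f)$ between open subsets of $X$, under composition of partial maps: $\mathrm{dom}(f\circ g)=\{x\in\mathrm{dom}(g): g(x)\in\mathrm{dom}(f)\}$. For $K\subseteq X$ compact and $V\subseteq X$ open, $\langle K;V\rangle=\{f\in\Gamma(X): K\subseteq\mathrm{dom}(f),\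 f(K)\subseteq V\}$ and $\langle K;V\rangle^{-1}=\{f\in\Gamma(X): f^{-1}\in\langle K;V\rangle\}$; $\tau_{ico}$ is the topology on $\Gamma(X)$ generated by all these sets. $CL(X)$ is the set of closed subsets of $X$ (including $\emptyset$) with the Fell topology, whose subbasis consists of $V^-=\{A: A\cap V\neq\emptyset\}$ for $V$ open and $W^+=\{A: A\subseteq W\}$ for $W$ open with $X\setminus W$ compact. Let $\mathsf{D}(f)=X\setminus\mathrm{dom}(f)$ and $\mathsf{I}(f)=X\setminus\mathrm{im}(f)$. The topology $\tau_{hco}$ on $\Gamma(X)$ is generated by $\tau_{ico}$ together with the sets $\mathsf{D}^{-1}(U)$ and $\mathsf{I}^{-1}(U)$ for $U$ Fell-open in $CL(X)$. *)

theory Defs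
  imports "HOL-Analysis.Analysis" "HOL-Algebra.Coset"
begin

section \<open>Inverse monoids and unital premorphisms\<close>

definition is_sinv :: "('a, 'm) monoid_scheme \<Rightarrow> 'a \<Rightarrow> 'a \<Rightarrow> bool" where
  "is_sinv M x y \<longleftrightarrow> y \<in> carrier M \<and>
     x \<otimes>\<^bsub>M\<^esub> y \<otimes>\<^bsub>M\<^esub> x = x \<and> y \<otimes>\<^bsub>M\<^esub> x \<otimes>\<^bsub>M\<^esub> y = y"

definition inverse_monoid :: "('a, 'm) monoid_scheme \<Rightarrow> bool" where
  "inverse_monoid M \<longleftrightarrow> monoid M \<and> (\<forall>x\<in>carrier M. \<exists>!y. is_sinv M x y)"

text \<open>The semigroup inverse; it differs from the library's \<open>m_inv\<close>, which is the inverse of a unit.\<close>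

definition sinv :: "('a, 'm) monoid_scheme \<Rightarrow> 'a \<Rightarrow> 'a" where
  "sinv M x = (THE y. is_sinv M x y)"

definition natural_le :: "('a, 'm) monoid_scheme \<Rightarrow> 'a \<Rightarrow> 'a \<Rightarrow> bool" where
  "natural_le M s t \<longleftrightarrow>
     (\<exists>e\<in>carrier M. e \<otimes>\<^bsub>M\<^esub> e = e \<and> s = e \<otimes>\<^bsub>M\<^esub> t)"

definition inverse_subsemigroup :: "'a set \<Rightarrow> ('a, 'm) monoid_scheme \<Rightarrow> bool" where
  "inverse_subsemigroup S M \<longleftrightarrow> S \<subseteq> carrier M \<and>
     (\<forall>x\<in>S. \<forall>y\<in>S. x \<otimes>\<^bsub>M\<^esub> y \<in> S) \<and> (\<forall>x\<in>S. sinv M x \<in> S)"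

definition unital_premorphism ::
    "('g, 'n) monoid_scheme \<Rightarrow> ('a, 'm) monoid_scheme \<Rightarrow> ('g \<Rightarrow> 'a) \<Rightarrow> bool" where
  "unital_premorphism G M \<theta> \<longleftrightarrow> group G \<and> inverse_monoid M \<and>
     \<theta> \<in> carrier G \<rightarrow> carrier M \<and>
     \<theta> \<one>\<^bsub>G\<^esub> = \<one>\<^bsub>M\<^esub> \<and>
     (\<forall>g\<in>carrier G. \<theta> (inv\<^bsub>G\<^esub> g) = sinv M (\<theta> g)) \<and>
     (\<forall>g\<in>carrier G. \<forall>h\<in>carrier G.
        natural_le M (\<theta> g \<otimes>\<^bsub>M\<^esub> \<theta> h) (\<theta> (g \<otimes>\<^bsub>G\<^esub> h)))"


section \<open>Topological groups and the expansion by compact sets\<close>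

text \<open>As usual in the abstract setting, no separation axiom is included.\<close>

definition topological_group :: "('g, 'n) monoid_scheme \<Rightarrow> 'g topology \<Rightarrow> bool" where
  "topological_group G T \<longleftrightarrow> group G \<and> topspace T = carrier G \<and>
     continuous_map (prod_topology T T) T (\<lambda>(x, y). x \<otimes>\<^bsub>G\<^esub> y) \<and>
     continuous_map T T (\<lambda>x. inv\<^bsub>G\<^esub> x)"

text \<open>The basic set \<open>N(U\<^sub>1,\<dots>,U\<^sub>n)\<close> depends only on the finite set of the \<open>U\<^sub>i\<close>. The empty
  family is allowed: it gives \<open>{{}}\<close>, the only basic set containing the empty compact set.\<close>

definition vietoris_basic :: "'a topology \<Rightarrow> 'a set set \<Rightarrow> 'a set set" where
  "vietoris_basic T \<U> = {K. compactin T K \<and> K \<subseteq> \<Union>\<U> \<and> (\<forall>U\<in>\<U>. K \<inter> U \<noteq> {})}"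

definition vietoris :: "'a topology \<Rightarrow> 'a set topology" where
  "vietoris T =
     topology_generated_by {vietoris_basic T \<U> |\<U>. finite \<U> \<and> (\<forall>U\<in>\<U>. openin T U)}"

definition expansion :: "('g, 'n) monoid_scheme \<Rightarrow> 'g topology \<Rightarrow> ('g set \<times> 'g) monoid" where
  "expansion G T =
     \<lparr>carrier = {(A, g). compactin T A \<and> g \<in> carrier G \<and> {\<one>\<^bsub>G\<^esub>, g} \<subseteq> A},
      mult = (\<lambda>(A, g) (B, h). (A \<union> (g <#\<^bsub>G\<^esub> B), g \<otimes>\<^bsub>G\<^esub> h)),
      one = ({\<one>\<^bsub>G\<^esub>}, \<one>\<^bsub>G\<^esub>)\<rparr>"

definition expansion_topology ::
    "('g, 'n) monoid_scheme \<Rightarrow> 'g topology \<Rightarrow> ('g set \<times> 'g) topology" where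
  "expansion_topology G T =
     subtopology (prod_topology (vietoris T) T) (carrier (expansion G T))"


section \<open>Partial homeomorphisms\<close>

definition partial_homeo :: "'b topology \<Rightarrow> ('b \<rightharpoonup> 'b) \<Rightarrow> bool" where
  "partial_homeo X f \<longleftrightarrow> openin X (dom f) \<and> openin X (ran f) \<and>
     homeomorphic_map (subtopology X (dom f)) (subtopology X (ran f)) (the \<circ> f)"

definition PHomeo :: "'b topology \<Rightarrow> ('b \<rightharpoonup> 'b) monoid" where
  "PHomeo X =
     \<lparr>carrier = {f. partial_homeo X f}, mult = (\<circ>\<^sub>m),
      one = (\<lambda>x. if x \<in> topspace X then Some x else None)\<rparr>"

definition pinv :: "('b \<rightharpoonup> 'b) \<Rightarrow> ('b \<rightharpoonup> 'b)" where
  "pinv f = (\<lambda>y. if y \<in> ran f then Some (THE x. f x = Some y) else None)"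

definition ico_set :: "'b topology \<Rightarrow> 'b set \<Rightarrow> 'b set \<Rightarrow> ('b \<rightharpoonup> 'b) set" where
  "ico_set X K V = {f \<in> carrier (PHomeo X). K \<subseteq> dom f \<and> (the \<circ> f) ` K \<subseteq> V}"

definition ico_set_inv :: "'b topology \<Rightarrow> 'b set \<Rightarrow> 'b set \<Rightarrow> ('b \<rightharpoonup> 'b) set" where
  "ico_set_inv X K V = {f \<in> carrier (PHomeo X). pinv f \<in> ico_set X K V}"

definition tau_ico :: "'b topology \<Rightarrow> ('b \<rightharpoonup> 'b) topology" where
  "tau_ico X = topology_generated_by
     ({ico_set X K V |K V. compactin X K \<and> openin X V} \<union>
      {ico_set_inv X K V |K V. compactin X K \<and> openin X V})"

definition fell :: "'b topology \<Rightarrow> 'b set topology" where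
  "fell X = topology_generated_by
     ({{A. closedin X A \<and> A \<inter> V \<noteq> {}} |V. openin X V} \<union>
      {{A. closedin X A \<and> A \<subseteq> W} |W. openin X W \<and> compactin X (topspace X - W)})"

definition co_dom :: "'b topology \<Rightarrow> ('b \<rightharpoonup> 'b) \<Rightarrow> 'b set" where
  "co_dom X f = topspace X - dom f"

definition co_im :: "'b topology \<Rightarrow> ('b \<rightharpoonup> 'b) \<Rightarrow> 'b set" where
  "co_im X f = topspace X - ran f"

definition tau_hco :: "'b topology \<Rightarrow> ('b \<rightharpoonup> 'b) topology" where
  "tau_hco X = topology_generated_by
     ({U. openin (tau_ico X) U} \<union>
      {{f \<in> carrier (PHomeo X). co_dom X f \<in> U} |U. openin (fell X) U} \<union>
      {{f \<in> carrier (PHomeo X). co_im X f \<in> U} |U. openin (fell X) U})"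


section \<open>Basic facts\<close>

lemma topspace_vietoris: "topspace (vietoris T) = {K. compactin T K}"
proof -
  have "K \<in> topspace (vietoris T)" if K: "compactin T K" for K
  proof (cases "K = {}")
    case True
    then have "K \<in> vietoris_basic T {}" by (simp add: vietoris_basic_def)
    moreover have "finite {}" "\<forall>U\<in>{}. openin T U" by auto
    ultimately show ?thesis unfolding vietoris_def topology_generated_by_topspace by blast
  next
    case False
    then have "K \<in> vietoris_basic T {topspace T}"
      using K compactin_subset_topspace[OF K] by (auto simp: vietoris_basic_def)
    moreover have "finite {topspace T}" "\<forall>U\<in>{topspace T}. openin T U" by auto
    ultimately show ?thesis unfolding vietoris_def topology_generated_by_topspace by blast
  qed
  then show ?thesis
    by (auto simp: vietoris_def topology_generated_by_topspace vietoris_basic_def)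
qed

lemma topspace_fell: "topspace (fell X) = {A. closedin X A}"
proof -
  have "{A. closedin X A \<and> A \<subseteq> topspace X} \<in>
      {{A. closedin X A \<and> A \<subseteq> W} |W. openin X W \<and> compactin X (topspace X - W)}"
    by (rule CollectI, rule exI[of _ "topspace X"]) auto
  then have "{A. closedin X A \<and> A \<subseteq> topspace X} \<subseteq> topspace (fell X)"
    unfolding fell_def topology_generated_by_topspace by blast
  then have "{A. closedin X A} \<subseteq> topspace (fell X)"
    by (auto dest: closedin_subset)
  moreover have "topspace (fell X) \<subseteq> {A. closedin X A}"
    unfolding fell_def topology_generated_by_topspace by blast
  ultimately show ?thesis by (rule subset_antisym[rotated])
qed

lemma topspace_tau_ico: "topspace (tau_ico X) = carrier (PHomeo X)"
proof -
  have "ico_set X {} {} \<in> {ico_set X K V |K V. compactin X K \<and> openin X V}"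
    by (rule CollectI, rule exI[of _ "{}"], rule exI[of _ "{}"]) simp
  moreover have "ico_set X {} {} = carrier (PHomeo X)" by (auto simp: ico_set_def)
  ultimately have "carrier (PHomeo X) \<subseteq> topspace (tau_ico X)"
    unfolding tau_ico_def topology_generated_by_topspace by blast
  moreover have "ico_set X K V \<subseteq> carrier (PHomeo X)" "ico_set_inv X K V \<subseteq> carrier (PHomeo X)" for K V
    by (auto simp: ico_set_def ico_set_inv_def)
  then have "topspace (tau_ico X) \<subseteq> carrier (PHomeo X)"
    unfolding tau_ico_def topology_generated_by_topspace by blast
  ultimately show ?thesis by (rule subset_antisym[rotated])
qed

lemma topspace_tau_hco: "topspace (tau_hco X) = carrier (PHomeo X)"
proof -
  have "openin (tau_ico X) (carrier (PHomeo X))"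
    using openin_topspace[of "tau_ico X"] unfolding topspace_tau_ico .
  then have "carrier (PHomeo X) \<subseteq> topspace (tau_hco X)"
    unfolding tau_hco_def topology_generated_by_topspace by blast
  moreover have "U \<subseteq> carrier (PHomeo X)" if "openin (tau_ico X) U" for U
    using openin_subset[OF that] unfolding topspace_tau_ico .
  then have "topspace (tau_hco X) \<subseteq> carrier (PHomeo X)"
    unfolding tau_hco_def topology_generated_by_topspace by blast
  ultimately show ?thesis by (rule subset_antisym[rotated])
qed

lemma partial_homeo_subset:
  assumes "partial_homeo X f"
  shows "dom f \<subseteq> topspace X" "ran f \<subseteq> topspace X"
proof -
  have "openin X (dom f)" "openin X (ran f)"
    using assms by (simp_all only: partial_homeo_def)
  then show "dom f \<subseteq> topspace X" "ran f \<subseteq> topspace X"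
    by (simp_all only: openin_subset)
qed

lemma partial_homeo_inj:
  assumes "partial_homeo X f" "f x = Some y" "f x' = Some y"
  shows "x = x'"
proof -
  have sub: "dom f \<subseteq> topspace X"
    by (rule partial_homeo_subset(1)[OF assms(1)])
  have "inj_on (the \<circ> f) (topspace (subtopology X (dom f)))"
    using assms(1) unfolding partial_homeo_def homeomorphic_map_def by blast
  then have "inj_on (the \<circ> f) (dom f)"
    using sub by (simp add: Int_absorb1)
  then show ?thesis
    using assms(2,3) by (metis comp_apply domI inj_onD option.sel)
qed

lemma pinv_eq_Some_iff:
  assumes "partial_homeo X f"
  shows "pinv f y = Some x \<longleftrightarrow> f x = Some y"
proof
  assume h: "f x = Some y"
  then have "(THE x. f x = Some y) = x"
    using partial_homeo_inj[OF assms] by blast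
  with h show "pinv f y = Some x" by (auto simp: pinv_def ran_def)
next
  assume h: "pinv f y = Some x"
  then have "y \<in> ran f" and x: "x = (THE x. f x = Some y)"
    by (auto simp: pinv_def split: if_splits)
  then obtain x' where x': "f x' = Some y" by (auto simp: ran_def)
  then have "x = x'" using x partial_homeo_inj[OF assms] by blast
  then show "f x = Some y" using x' by simp
qed

lemma dom_pinv [simp]: "dom (pinv f) = ran f"
  by (auto simp: pinv_def dom_def)

lemma ran_pinv:
  assumes "partial_homeo X f"
  shows "ran (pinv f) = dom f"
  using pinv_eq_Some_iff[OF assms] by (auto simp: ran_def dom_def)

lemma partial_homeo_pinv:
  assumes f: "partial_homeo X f"
  shows "partial_homeo X (pinv f)"
proof -
  obtain g where g: "homeomorphic_maps (subtopology X (dom f)) (subtopology X (ran f)) (the \<circ> f) g"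
    using f homeomorphic_map_maps unfolding partial_homeo_def by blast
  have sub: "dom f \<subseteq> topspace X" "ran f \<subseteq> topspace X"
    by (rule partial_homeo_subset[OF f])+
  have "g y = (the \<circ> pinv f) y" if y: "y \<in> topspace (subtopology X (ran f))" for y
  proof -
    obtain x where x: "f x = Some y" using y by (auto simp: ran_def)
    then have "x \<in> topspace (subtopology X (dom f))" using sub by auto
    then have "g ((the \<circ> f) x) = x" using g by (auto simp: homeomorphic_maps_def)
    then show ?thesis using x pinv_eq_Some_iff[OF f, of y x] by simp
  qed
  then have "homeomorphic_map (subtopology X (ran f)) (subtopology X (dom f)) (the \<circ> pinv f)"
    using g homeomorphic_map_eq homeomorphic_maps_map by blast
  then show ?thesis
    using f by (simp add: partial_homeo_def ran_pinv[OF f])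
qed

lemma partial_homeoI:
  assumes "\<And>x x' y. f x = Some y \<Longrightarrow> f x' = Some y \<Longrightarrow> x = x'"
    and "openin X (dom f)" "openin X (ran f)"
    and "continuous_map (subtopology X (dom f)) X (the \<circ> f)"
    and "continuous_map (subtopology X (ran f)) X (the \<circ> pinv f)"
  shows "partial_homeo X f"
proof -
  have P: "pinv f y = Some x" if "f x = Some y" for x y
  proof -
    have "(THE x. f x = Some y) = x" using that assms(1) by blast
    then show ?thesis using that by (auto simp: pinv_def ran_def)
  qed
  have 1: "continuous_map (subtopology X (dom f)) (subtopology X (ran f)) (the \<circ> f)"
    using assms(4) by (auto simp: continuous_map_in_subtopology ran_def)
  have 2: "continuous_map (subtopology X (ran f)) (subtopology X (dom f)) (the \<circ> pinv f)"
    using assms(5) P by (fastforce simp: continuous_map_in_subtopology ran_def)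
  have "homeomorphic_maps (subtopology X (dom f)) (subtopology X (ran f)) (the \<circ> f) (the \<circ> pinv f)"
    using 1 2 P by (auto simp: homeomorphic_maps_def ran_def)
  then show ?thesis
    using assms(2,3) homeomorphic_map_maps by (auto simp: partial_homeo_def)
qed

lemma partial_homeo_continuous:
  assumes "partial_homeo X f"
  shows "continuous_map (subtopology X (dom f)) X (the \<circ> f)"
proof -
  have "homeomorphic_map (subtopology X (dom f)) (subtopology X (ran f)) (the \<circ> f)"
    using assms unfolding partial_homeo_def by blast
  then show ?thesis
    using homeomorphic_imp_continuous_map continuous_map_in_subtopology by blast
qed

lemma openin_dom_map_comp:
  assumes f: "partial_homeo X f" and g: "partial_homeo X g"
  shows "openin X (dom (f \<circ>\<^sub>m g))"
proof -
  have "dom (f \<circ>\<^sub>m g) = {x \<in> topspace (subtopology X (dom g)). (the \<circ> g) x \<in> dom f}"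
    using partial_homeo_subset(1)[OF g]
    by (auto simp: map_comp_def dom_def split: option.splits)
  moreover have "openin (subtopology X (dom g)) \<dots>"
    by (rule openin_continuous_map_preimage[OF partial_homeo_continuous[OF g]])
       (use f in \<open>simp add: partial_homeo_def\<close>)
  ultimately show ?thesis
    using g openin_open_subtopology by (metis partial_homeo_def)
qed

lemma pinv_map_comp:
  assumes f: "partial_homeo X f" and g: "partial_homeo X g"
  shows "pinv (f \<circ>\<^sub>m g) = pinv g \<circ>\<^sub>m pinv f"
proof -
  have inj: "x = x'" if "(f \<circ>\<^sub>m g) x = Some y" "(f \<circ>\<^sub>m g) x' = Some y" for x x' y
    using that partial_homeo_inj[OF f] partial_homeo_inj[OF g]
    unfolding map_comp_Some_iff by metis
  have "pinv (f \<circ>\<^sub>m g) y = Some x \<longleftrightarrow> (f \<circ>\<^sub>m g) x = Some y" for x y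
  proof
    assume h: "(f \<circ>\<^sub>m g) x = Some y"
    then have "(THE x. (f \<circ>\<^sub>m g) x = Some y) = x" using inj by blast
    with h show "pinv (f \<circ>\<^sub>m g) y = Some x" unfolding pinv_def ran_def by auto
  next
    assume h: "pinv (f \<circ>\<^sub>m g) y = Some x"
    then have "y \<in> ran (f \<circ>\<^sub>m g)" and x: "x = (THE x. (f \<circ>\<^sub>m g) x = Some y)"
      by (auto simp: pinv_def split: if_splits)
    then obtain x' where x': "(f \<circ>\<^sub>m g) x' = Some y" by (auto simp: ran_def)
    then have "x = x'" using x inj by blast
    then show "(f \<circ>\<^sub>m g) x = Some y" using x' by simp
  qed
  moreover have "(pinv g \<circ>\<^sub>m pinv f) y = Some x \<longleftrightarrow> (f \<circ>\<^sub>m g) x = Some y" for x y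
    by (auto simp: map_comp_Some_iff pinv_eq_Some_iff[OF f] pinv_eq_Some_iff[OF g])
  ultimately show ?thesis
    by (intro ext) (metis not_Some_eq)
qed

lemma continuous_map_comp_partial:
  assumes f: "partial_homeo X f" and g: "partial_homeo X g"
  shows "continuous_map (subtopology X (dom (f \<circ>\<^sub>m g))) X (the \<circ> (f \<circ>\<^sub>m g))"
proof -
  have sub: "dom (f \<circ>\<^sub>m g) \<subseteq> dom g"
    by (auto simp: map_comp_Some_iff)
  have "continuous_map (subtopology X (dom (f \<circ>\<^sub>m g))) X (the \<circ> g)"
    using continuous_map_from_subtopology_mono[OF partial_homeo_continuous[OF g] sub] .
  then have "continuous_map (subtopology X (dom (f \<circ>\<^sub>m g))) (subtopology X (dom f)) (the \<circ> g)"
    by (auto simp: continuous_map_in_subtopology map_comp_Some_iff)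
  from continuous_map_compose[OF this partial_homeo_continuous[OF f]]
  show ?thesis
    by (rule continuous_map_eq) (auto simp: map_comp_Some_iff)
qed

lemma partial_homeo_map_comp:
  assumes f: "partial_homeo X f" and g: "partial_homeo X g"
  shows "partial_homeo X (f \<circ>\<^sub>m g)"
proof (rule partial_homeoI)
  note p = partial_homeo_pinv[OF f] partial_homeo_pinv[OF g]
  have r: "ran (f \<circ>\<^sub>m g) = dom (pinv g \<circ>\<^sub>m pinv f)"
    using pinv_map_comp[OF f g] dom_pinv by metis
  show "x = x'" if "(f \<circ>\<^sub>m g) x = Some y" "(f \<circ>\<^sub>m g) x' = Some y" for x x' y
    using that partial_homeo_inj[OF f] partial_homeo_inj[OF g]
    unfolding map_comp_Some_iff by metis
  show "openin X (dom (f \<circ>\<^sub>m g))" by (rule openin_dom_map_comp[OF f g])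
  show "openin X (ran (f \<circ>\<^sub>m g))" unfolding r by (rule openin_dom_map_comp[OF p(2,1)])
  show "continuous_map (subtopology X (dom (f \<circ>\<^sub>m g))) X (the \<circ> (f \<circ>\<^sub>m g))"
    by (rule continuous_map_comp_partial[OF f g])
  show "continuous_map (subtopology X (ran (f \<circ>\<^sub>m g))) X (the \<circ> pinv (f \<circ>\<^sub>m g))"
    unfolding r pinv_map_comp[OF f g] by (rule continuous_map_comp_partial[OF p(2,1)])
qed

lemma partial_homeo_one: "partial_homeo X \<one>\<^bsub>PHomeo X\<^esub>"
proof (rule partial_homeoI)
  let ?e = "\<one>\<^bsub>PHomeo X\<^esub>"
  have d: "dom ?e = topspace X" and r: "ran ?e = topspace X"
    by (auto simp: PHomeo_def dom_def ran_def)
  have p: "pinv ?e y = Some y" if "y \<in> topspace X" for y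
    using that by (auto simp: pinv_def r) (auto simp: PHomeo_def)
  show "x = x'" if "?e x = Some y" "?e x' = Some y" for x x' y
    using that by (auto simp: PHomeo_def split: if_splits)
  show "openin X (dom ?e)" "openin X (ran ?e)" by (simp_all add: d r)
  show "continuous_map (subtopology X (dom ?e)) X (the \<circ> ?e)"
    by (rule continuous_map_eq[OF continuous_map_from_subtopology[OF continuous_map_id]])
       (auto simp: PHomeo_def)
  show "continuous_map (subtopology X (ran ?e)) X (the \<circ> pinv ?e)"
    by (rule continuous_map_eq[OF continuous_map_from_subtopology[OF continuous_map_id]])
       (auto simp: r p)
qed

lemma map_comp_assoc: "(f \<circ>\<^sub>m g) \<circ>\<^sub>m h = f \<circ>\<^sub>m (g \<circ>\<^sub>m h)"
  by (auto simp: map_comp_def fun_eq_iff split: option.splits)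

lemma monoid_PHomeo: "monoid (PHomeo X)"
proof (rule monoidI)
  fix f g h
  assume f: "f \<in> carrier (PHomeo X)"
  then have s: "dom f \<subseteq> topspace X" "ran f \<subseteq> topspace X"
    using partial_homeo_subset[of X f] by (simp_all add: PHomeo_def)
  show "\<one>\<^bsub>PHomeo X\<^esub> \<otimes>\<^bsub>PHomeo X\<^esub> f = f"
    using s(2) by (auto simp: PHomeo_def map_comp_def fun_eq_iff ran_def split: option.splits)
  show "f \<otimes>\<^bsub>PHomeo X\<^esub> \<one>\<^bsub>PHomeo X\<^esub> = f"
    using s(1) by (auto simp: PHomeo_def map_comp_def fun_eq_iff intro: sym[of "f _" None])
next
  show "\<one>\<^bsub>PHomeo X\<^esub> \<in> carrier (PHomeo X)"
    using partial_homeo_one by (simp add: PHomeo_def)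
qed (auto simp: PHomeo_def map_comp_assoc intro: partial_homeo_map_comp)

lemma is_sinv_PHomeo_iff:
  assumes "f \<in> carrier (PHomeo X)"
  shows "is_sinv (PHomeo X) f g \<longleftrightarrow> g = pinv f"
proof
  have f: "partial_homeo X f" using assms by (simp add: PHomeo_def)
  note pf = pinv_eq_Some_iff[OF f]
  {
    assume "g = pinv f"
    moreover have "f \<circ>\<^sub>m pinv f \<circ>\<^sub>m f = f"
    proof
      fix x show "(f \<circ>\<^sub>m pinv f \<circ>\<^sub>m f) x = f x"
      proof (cases "f x")
        case (Some a)
        then have "pinv f a = Some x" by (simp only: pf)
        with Some show ?thesis by (simp add: map_comp_def)
      qed (simp add: map_comp_def)
    qed
    moreover have "pinv f \<circ>\<^sub>m f \<circ>\<^sub>m pinv f = pinv f"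
    proof
      fix y show "(pinv f \<circ>\<^sub>m f \<circ>\<^sub>m pinv f) y = pinv f y"
      proof (cases "pinv f y")
        case (Some a)
        then have "f a = Some y" by (simp only: pf)
        with Some show ?thesis by (simp add: map_comp_def)
      qed (simp add: map_comp_def)
    qed
    ultimately show "is_sinv (PHomeo X) f g"
      using partial_homeo_pinv[OF f] by (simp add: is_sinv_def PHomeo_def)
  }
  assume "is_sinv (PHomeo X) f g"
  then have g: "partial_homeo X g" and fgf: "f \<circ>\<^sub>m g \<circ>\<^sub>m f = f" and gfg: "g \<circ>\<^sub>m f \<circ>\<^sub>m g = g"
    by (auto simp: is_sinv_def PHomeo_def)
  have "g y = Some x \<longleftrightarrow> f x = Some y" for x y
  proof
    assume "f x = Some y"
    then have "(f \<circ>\<^sub>m g \<circ>\<^sub>m f) x = Some y" using fgf by simp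
    then show "g y = Some x"
      using \<open>f x = Some y\<close> partial_homeo_inj[OF f] by (auto simp: map_comp_Some_iff)
  next
    assume "g y = Some x"
    then have "(g \<circ>\<^sub>m f \<circ>\<^sub>m g) y = Some x" using gfg by simp
    then show "f x = Some y"
      using \<open>g y = Some x\<close> partial_homeo_inj[OF g] by (auto simp: map_comp_Some_iff)
  qed
  then show "g = pinv f"
    by (intro ext) (metis not_Some_eq pf)
qed

lemma inverse_monoid_PHomeo: "inverse_monoid (PHomeo X)"
  using is_sinv_PHomeo_iff monoid_PHomeo by (auto simp: inverse_monoid_def)

lemma sinv_PHomeo: "f \<in> carrier (PHomeo X) \<Longrightarrow> sinv (PHomeo X) f = pinv f"
  by (simp add: sinv_def is_sinv_PHomeo_iff)

lemma is_sinv_sub_iff: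
  assumes "inverse_subsemigroup S (PHomeo X)" "f \<in> S"
  shows "is_sinv (PHomeo X\<lparr>carrier := S, one := e\<rparr>) f g \<longleftrightarrow> g = pinv f"
proof -
  have "f \<in> carrier (PHomeo X)" "pinv f \<in> S" "S \<subseteq> carrier (PHomeo X)"
    using assms sinv_PHomeo[of f X] unfolding inverse_subsemigroup_def by (blast, metis subsetD, blast)
  then show ?thesis
    using is_sinv_PHomeo_iff[of f X g] by (auto simp: is_sinv_def)
qed

lemma inverse_monoid_sub:
  assumes "inverse_subsemigroup S (PHomeo X)" "monoid (PHomeo X\<lparr>carrier := S, one := e\<rparr>)"
  shows "inverse_monoid (PHomeo X\<lparr>carrier := S, one := e\<rparr>)"
  unfolding inverse_monoid_def
proof (intro conjI ballI)
  fix f assume "f \<in> carrier (PHomeo X\<lparr>carrier := S, one := e\<rparr>)"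
  then have "f \<in> S" by simp
  then show "\<exists>!g. is_sinv (PHomeo X\<lparr>carrier := S, one := e\<rparr>) f g"
    by (simp only: is_sinv_sub_iff[OF assms(1)] simp_thms ex1_eq)
qed (rule assms(2))

lemma sinv_sub:
  assumes "inverse_subsemigroup S (PHomeo X)" "f \<in> S"
  shows "sinv (PHomeo X\<lparr>carrier := S, one := e\<rparr>) f = pinv f"
  by (simp add: sinv_def is_sinv_sub_iff[OF assms])

end

theory Submission
  imports Defs
begin

text \<open>
  For \<open>(A, g)\<close> in the expansion put \<open>E A = (\<Inter>a\<in>A. ran (\<theta> a))\<close> and let \<open>\<theta>\<^sup>* (A, g)\<close>, called \<open>theta_ext\<close>
  below, be the restriction of \<open>\<theta> g\<close> to the points that it sends into \<open>E A\<close>. This is the infinite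
  product, over \<open>a \<in> A\<close>, of the idempotents \<open>\<theta> a (\<theta> a)\<^sup>-\<^sup>1\<close>, multiplied by \<open>\<theta> g\<close>.

  The product exists in \<open>S\<close> for two reasons. Local compactness of \<open>X\<close> and compactness of \<open>A\<close> make \<open>E A\<close>
  open: a point of \<open>ran (\<theta> a)\<close> has a compact neighbourhood inside \<open>ran (\<theta> b)\<close> for all \<open>b\<close> near \<open>a\<close>, and
  \<open>A\<close> is covered by finitely many such sets of \<open>b\<close> (\<open>openin_INT_ran_compactin\<close>). The finite partial products lie in
  \<open>S\<close>, and they converge to \<open>\<theta>\<^sup>* (A, g)\<close> in \<open>\<tau>\<^sub>h\<^sub>c\<^sub>o\<close> because they decrease to it
  (\<open>limitin_tau_hco_of_extensions\<close>); as \<open>S\<close> is closed, it contains the limit.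

  All the algebra is in one equivalence (\<open>ran_iff_translate\<close>): if \<open>\<theta> g\<close> sends \<open>x\<close> to \<open>y\<close>, then
  \<open>y \<in> ran (\<theta> a)\<close> iff \<open>x \<in> ran (\<theta> (g\<^sup>-\<^sup>1 a))\<close>. It gives multiplicativity, and it shows that the domain of
  \<open>\<theta>\<^sup>* (A, g)\<close> is the intersection of the sets \<open>ran (\<theta> (g\<^sup>-\<^sup>1 a))\<close>, just as its range is the intersection
  of the sets \<open>ran (\<theta> a)\<close>. So the preimage under \<open>\<theta>\<^sup>*\<close> of each subbasic set of \<open>\<tau>\<^sub>h\<^sub>c\<^sub>o\<close> is described
  by conditions of the form ``for all \<open>a \<in> A\<close>'' or ``for some \<open>a \<in> A\<close>'', open in the pair \<open>(a, g)\<close>,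
  and by conditions on \<open>\<theta> g\<close> alone. The Vietoris topology, with the tube lemma for the universal
  quantifier, makes the quantified conditions open.
\<close>

section \<open>Generated topologies and the Vietoris topology\<close>

lemma limitin_topology_generated_by:
  assumes l: "l \<in> \<Union>\<S>"
    and ev: "\<And>U. U \<in> \<S> \<Longrightarrow> l \<in> U \<Longrightarrow> \<forall>\<^sub>F i in F. f i \<in> U"
  shows "limitin (topology_generated_by \<S>) f l F"
proof -
  have "l \<in> U \<longrightarrow> (\<forall>\<^sub>F i in F. f i \<in> U)" if "generate_topology_on \<S> U" for U
    using that
  proof induction
    case (Int a b)
    then show ?case by (auto intro: eventually_conj)
  next
    case (UN K)
    then show ?case by (blast intro: eventually_mono)
  qed (use ev in auto)
  with l show ?thesis
    by (simp add: limitin_def openin_topology_generated_by_iff)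
qed

lemma openin_vietoris_subset:
  assumes U: "openin T U"
  shows "openin (vietoris T) {K. compactin T K \<and> K \<subseteq> U}"
proof -
  \<comment> \<open>A nonempty family of open sets excludes the empty compact set, which has to be added.\<close>
  have "{K. compactin T K \<and> K \<subseteq> U} = vietoris_basic T {U} \<union> vietoris_basic T {}"
    by (auto simp: vietoris_basic_def)
  moreover have "openin (vietoris T) (vietoris_basic T \<U>)"
    if "finite \<U>" "\<forall>U\<in>\<U>. openin T U" for \<U>
    unfolding vietoris_def by (rule topology_generated_by_Basis) (use that in blast)
  ultimately show ?thesis using U by auto
qed

lemma openin_vietoris_meets:
  assumes U: "openin T U"
  shows "openin (vietoris T) {K. compactin T K \<and> K \<inter> U \<noteq> {}}"
proof -
  have "{K. compactin T K \<and> K \<inter> U \<noteq> {}} = vietoris_basic T {U, topspace T}"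
    using compactin_subset_topspace[of T] by (auto simp: vietoris_basic_def)
  also have "openin (vietoris T) \<dots>"
    unfolding vietoris_def by (rule topology_generated_by_Basis) (use U in blast)
  finally show ?thesis .
qed

text \<open>The tube lemma, read as a statement about quantification over a varying compact set.\<close>

lemma openin_vietoris_ball:
  assumes W: "openin (prod_topology T Y) W"
  shows "openin (prod_topology (vietoris T) Y)
     {(A, y). compactin T A \<and> y \<in> topspace Y \<and> (\<forall>a\<in>A. (a, y) \<in> W)}"
  unfolding openin_prod_topology_alt
proof (intro allI impI)
  fix A y
  assume "(A, y) \<in> {(A, y). compactin T A \<and> y \<in> topspace Y \<and> (\<forall>a\<in>A. (a, y) \<in> W)}"
  then have A: "compactin T A" "y \<in> topspace Y" "A \<times> {y} \<subseteq> W" by auto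
  then obtain U V where UV: "openin T U" "openin Y V" "A \<subseteq> U" "y \<in> V" "U \<times> V \<subseteq> W"
    using tube_lemma_left[OF W] by meson
  have "{K. compactin T K \<and> K \<subseteq> U} \<times> V \<subseteq>
      {(A, y). compactin T A \<and> y \<in> topspace Y \<and> (\<forall>a\<in>A. (a, y) \<in> W)}"
    using UV openin_subset[of Y V] by auto
  with UV A openin_vietoris_subset[OF UV(1)]
  show "\<exists>P V. openin (vietoris T) P \<and> openin Y V \<and> A \<in> P \<and> y \<in> V \<and> P \<times> V \<subseteq>
      {(A, y). compactin T A \<and> y \<in> topspace Y \<and> (\<forall>a\<in>A. (a, y) \<in> W)}"
    by (intro exI[of _ "{K. compactin T K \<and> K \<subseteq> U}"] exI[of _ V]) simp
qed

lemma openin_vietoris_bex: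
  assumes W: "openin (prod_topology T Y) W"
  shows "openin (prod_topology (vietoris T) Y)
     {(A, y). compactin T A \<and> y \<in> topspace Y \<and> (\<exists>a\<in>A. (a, y) \<in> W)}"
  unfolding openin_prod_topology_alt
proof (intro allI impI)
  fix A y
  assume "(A, y) \<in> {(A, y). compactin T A \<and> y \<in> topspace Y \<and> (\<exists>a\<in>A. (a, y) \<in> W)}"
  then obtain a where A: "compactin T A" "y \<in> topspace Y" "a \<in> A" "(a, y) \<in> W" by auto
  then obtain U V where UV: "openin T U" "openin Y V" "a \<in> U" "y \<in> V" "U \<times> V \<subseteq> W"
    using W unfolding openin_prod_topology_alt by meson
  have "{K. compactin T K \<and> K \<inter> U \<noteq> {}} \<times> V \<subseteq>
      {(A, y). compactin T A \<and> y \<in> topspace Y \<and> (\<exists>a\<in>A. (a, y) \<in> W)}"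
    using UV openin_subset[of Y V] by auto
  moreover have "A \<inter> U \<noteq> {}" using UV A by blast
  ultimately
  show "\<exists>P V. openin (vietoris T) P \<and> openin Y V \<and> A \<in> P \<and> y \<in> V \<and> P \<times> V \<subseteq>
      {(A, y). compactin T A \<and> y \<in> topspace Y \<and> (\<exists>a\<in>A. (a, y) \<in> W)}"
    using UV A openin_vietoris_meets[OF UV(1)]
    by (intro exI[of _ "{K. compactin T K \<and> K \<inter> U \<noteq> {}}"] exI[of _ V]) simp
qed

section \<open>The topology of partial homeomorphisms\<close>

lemma ico_set_eq:
  "ico_set X K V =
     {f \<in> carrier (PHomeo X). K \<subseteq> dom f \<and> (\<forall>x y. f x = Some y \<longrightarrow> x \<in> K \<longrightarrow> y \<in> V)}"
proof -
  have "(the \<circ> f) ` K \<subseteq> V \<longleftrightarrow> (\<forall>x y. f x = Some y \<longrightarrow> x \<in> K \<longrightarrow> y \<in> V)"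
    if "K \<subseteq> dom f" for f :: "'a \<rightharpoonup> 'a"
    using that by (force simp: image_subset_iff)
  then show ?thesis unfolding ico_set_def by blast
qed

lemma ico_set_inv_eq:
  "ico_set_inv X K V =
     {f \<in> carrier (PHomeo X). K \<subseteq> ran f \<and> (\<forall>x y. f x = Some y \<longrightarrow> y \<in> K \<longrightarrow> x \<in> V)}"
proof -
  have "f \<in> ico_set_inv X K V \<longleftrightarrow>
      f \<in> carrier (PHomeo X) \<and> K \<subseteq> ran f \<and> (\<forall>x y. f x = Some y \<longrightarrow> y \<in> K \<longrightarrow> x \<in> V)" for f
  proof (cases "partial_homeo X f")
    case True
    then have "pinv f \<in> carrier (PHomeo X)" "f \<in> carrier (PHomeo X)"
      using partial_homeo_pinv by (simp_all add: PHomeo_def)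
    then show ?thesis
      unfolding ico_set_inv_def ico_set_eq mem_Collect_eq dom_pinv pinv_eq_Some_iff[OF True]
      by blast
  qed (simp add: ico_set_inv_def PHomeo_def)
  then show ?thesis by blast
qed

definition hco_subbase :: "'b topology \<Rightarrow> ('b \<rightharpoonup> 'b) set set" where
  "hco_subbase X =
     {ico_set X K V |K V. compactin X K \<and> openin X V} \<union>
     {ico_set_inv X K V |K V. compactin X K \<and> openin X V} \<union>
     {{f \<in> carrier (PHomeo X). \<not> V \<subseteq> dom f} |V. openin X V} \<union>
     {{f \<in> carrier (PHomeo X). \<not> V \<subseteq> ran f} |V. openin X V}"

lemma hco_subbase_cases [consumes 1, case_names ico ico_inv dom ran]:
  assumes "U \<in> hco_subbase X"
  obtains K V where "compactin X K" "openin X V" "U = ico_set X K V"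
    | K V where "compactin X K" "openin X V" "U = ico_set_inv X K V"
    | V where "openin X V" "U = {f \<in> carrier (PHomeo X). \<not> V \<subseteq> dom f}"
    | V where "openin X V" "U = {f \<in> carrier (PHomeo X). \<not> V \<subseteq> ran f}"
  using assms unfolding hco_subbase_def by (elim UnE CollectE exE conjE) (rule that; assumption)+

lemma hco_subbaseI:
  "compactin X K \<Longrightarrow> openin X V \<Longrightarrow> ico_set X K V \<in> hco_subbase X"
  "compactin X K \<Longrightarrow> openin X V \<Longrightarrow> ico_set_inv X K V \<in> hco_subbase X"
  "openin X V \<Longrightarrow> {f \<in> carrier (PHomeo X). \<not> V \<subseteq> dom f} \<in> hco_subbase X"
  "openin X V \<Longrightarrow> {f \<in> carrier (PHomeo X). \<not> V \<subseteq> ran f} \<in> hco_subbase X"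
  unfolding hco_subbase_def Un_iff mem_Collect_eq by metis+

lemma Union_hco_subbase: "\<Union> (hco_subbase X) = carrier (PHomeo X)"
proof
  show "\<Union> (hco_subbase X) \<subseteq> carrier (PHomeo X)"
    unfolding hco_subbase_def ico_set_def ico_set_inv_def by blast
  have "compactin X {}" "openin X {}" by simp_all
  then have "ico_set X {} {} \<in> hco_subbase X" by (rule hco_subbaseI(1))
  moreover have "ico_set X {} {} = carrier (PHomeo X)" by (auto simp: ico_set_def)
  ultimately show "carrier (PHomeo X) \<subseteq> \<Union> (hco_subbase X)" by blast
qed

lemma PHomeo_subset:
  assumes "f \<in> carrier (PHomeo X)"
  shows "dom f \<subseteq> topspace X" "ran f \<subseteq> topspace X"
  using assms partial_homeo_subset[of X f] by (simp_all add: PHomeo_def)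

lemma subset_dom_eq_ico_set:
  "{f \<in> carrier (PHomeo X). K \<subseteq> dom f} = ico_set X K (topspace X)"
  using PHomeo_subset(2) unfolding ico_set_eq by (blast intro: ranI)

lemma subset_ran_eq_ico_set_inv:
  "{f \<in> carrier (PHomeo X). K \<subseteq> ran f} = ico_set_inv X K (topspace X)"
  using PHomeo_subset(1) unfolding ico_set_inv_eq by (blast intro: domI)

lemma closedin_co_dom_co_im:
  assumes "f \<in> carrier (PHomeo X)"
  shows "closedin X (co_dom X f)" "closedin X (co_im X f)"
  using assms by (auto simp: PHomeo_def co_dom_def co_im_def partial_homeo_def)

lemma openin_tau_hco_if_ico:
  "openin (tau_ico X) N \<Longrightarrow> openin (tau_hco X) N"
  unfolding tau_hco_def by (intro topology_generated_by_Basis UnI1 CollectI)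

lemma openin_tau_hco_subbase:
  assumes "U \<in> hco_subbase X"
  shows "openin (tau_hco X) U"
  using assms
proof (cases rule: hco_subbase_cases)
  case (ico K V)
  then have "openin (tau_ico X) U"
    unfolding tau_ico_def by (intro topology_generated_by_Basis UnI1 CollectI) metis
  then show ?thesis by (rule openin_tau_hco_if_ico)
next
  case (ico_inv K V)
  then have "openin (tau_ico X) U"
    unfolding tau_ico_def by (intro topology_generated_by_Basis UnI2 CollectI) metis
  then show ?thesis by (rule openin_tau_hco_if_ico)
next
  case (dom V)
  let ?U = "{A. closedin X A \<and> A \<inter> V \<noteq> {}}"
  have "openin (fell X) ?U"
    unfolding fell_def using dom(1) by (intro topology_generated_by_Basis UnI1 CollectI) metis
  then have "openin (tau_hco X) {f \<in> carrier (PHomeo X). co_dom X f \<in> ?U}"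
    unfolding tau_hco_def by (intro topology_generated_by_Basis UnI1[OF UnI2] CollectI) metis
  also have "{f \<in> carrier (PHomeo X). co_dom X f \<in> ?U} = U"
    using closedin_co_dom_co_im(1) openin_subset[OF dom(1)] unfolding dom(2)
    by (auto simp: co_dom_def)
  finally show ?thesis .
next
  case (ran V)
  let ?U = "{A. closedin X A \<and> A \<inter> V \<noteq> {}}"
  have "openin (fell X) ?U"
    unfolding fell_def using ran(1) by (intro topology_generated_by_Basis UnI1 CollectI) metis
  then have "openin (tau_hco X) {f \<in> carrier (PHomeo X). co_im X f \<in> ?U}"
    unfolding tau_hco_def by (intro topology_generated_by_Basis UnI2 CollectI) metis
  also have "{f \<in> carrier (PHomeo X). co_im X f \<in> ?U} = U"
    using closedin_co_dom_co_im(2) openin_subset[OF ran(1)] unfolding ran(2)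
    by (auto simp: co_im_def)
  finally show ?thesis .
qed

text \<open>
  The Fell sets \<open>W\<^sup>+\<close> contribute nothing beyond \<open>\<tau>\<^sub>i\<^sub>c\<^sub>o\<close>: that the complement of \<open>dom f\<close> lies in \<open>W\<close>
  says that \<open>dom f\<close> contains the compact set \<open>X - W\<close>.
\<close>

lemma continuous_co_dom_co_im:
  "continuous_map (topology_generated_by (hco_subbase X)) (fell X) (co_dom X)" (is "continuous_map ?R _ _")
  "continuous_map (topology_generated_by (hco_subbase X)) (fell X) (co_im X)"
proof -
  have basic: "openin ?R N" if "N \<in> hco_subbase X" for N
    using that by (rule topology_generated_by_Basis)
  have top: "topspace ?R = carrier (PHomeo X)"
    by (simp only: topology_generated_by_topspace Union_hco_subbase)
  let ?F = "{{A. closedin X A \<and> A \<inter> V \<noteq> {}} |V. openin X V} \<union>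
      {{A. closedin X A \<and> A \<subseteq> W} |W. openin X W \<and> compactin X (topspace X - W)}"
  have pre: "openin ?R (co_dom X -` U \<inter> topspace ?R) \<and> openin ?R (co_im X -` U \<inter> topspace ?R)"
    if "U \<in> ?F" for U
  proof -
    from that consider
        V where "openin X V" "U = {A. closedin X A \<and> A \<inter> V \<noteq> {}}"
      | W where "openin X W" "compactin X (topspace X - W)" "U = {A. closedin X A \<and> A \<subseteq> W}"
      unfolding Un_iff mem_Collect_eq by metis
    then show ?thesis
    proof cases
      case 1
      have "co_dom X -` U \<inter> topspace ?R = {f \<in> carrier (PHomeo X). \<not> V \<subseteq> dom f}"
        "co_im X -` U \<inter> topspace ?R = {f \<in> carrier (PHomeo X). \<not> V \<subseteq> ran f}"
        using closedin_co_dom_co_im openin_subset[OF 1(1)] unfolding top 1(2)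
        by (auto simp: co_dom_def co_im_def)
      then show ?thesis using hco_subbaseI(3,4)[OF 1(1)] basic by simp
    next
      case 2
      let ?K = "topspace X - W"
      have "(co_dom X f \<subseteq> W) = (?K \<subseteq> dom f)" "(co_im X f \<subseteq> W) = (?K \<subseteq> ran f)" for f
        unfolding co_dom_def co_im_def by blast+
      then have "co_dom X -` U \<inter> topspace ?R = {f \<in> carrier (PHomeo X). ?K \<subseteq> dom f}"
        "co_im X -` U \<inter> topspace ?R = {f \<in> carrier (PHomeo X). ?K \<subseteq> ran f}"
        using closedin_co_dom_co_im unfolding top 2(3) by auto
      then show ?thesis
        using hco_subbaseI(1,2)[OF 2(2) openin_topspace] basic
        by (simp add: subset_dom_eq_ico_set subset_ran_eq_ico_set_inv)
    qed
  qed
  have range: "co_dom X ` topspace ?R \<subseteq> \<Union> ?F" "co_im X ` topspace ?R \<subseteq> \<Union> ?F"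
    unfolding top topspace_fell[of X, unfolded fell_def topology_generated_by_topspace]
    using closedin_co_dom_co_im by blast+
  show "continuous_map ?R (fell X) (co_dom X)"
    unfolding fell_def by (rule continuous_on_generated_topo[OF conjunct1[OF pre] range(1)])
  show "continuous_map ?R (fell X) (co_im X)"
    unfolding fell_def by (rule continuous_on_generated_topo[OF conjunct2[OF pre] range(2)])
qed

lemma tau_hco_eq_generated: "tau_hco X = topology_generated_by (hco_subbase X)" (is "_ = ?R")
proof -
  have top: "topspace ?R = carrier (PHomeo X)"
    by (simp only: topology_generated_by_topspace Union_hco_subbase)
  have ico: "openin ?R N" if "openin (tau_ico X) N" for N
  proof (rule generate_topology_on_coarsest[OF istopology_openin])
    show "generate_topology_on ({ico_set X K V |K V. compactin X K \<and> openin X V} \<union>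
       {ico_set_inv X K V |K V. compactin X K \<and> openin X V}) N"
      using that unfolding tau_ico_def by (rule openin_topology_generated_by)
    show "openin ?R N" if "N \<in> {ico_set X K V |K V. compactin X K \<and> openin X V} \<union>
       {ico_set_inv X K V |K V. compactin X K \<and> openin X V}" for N
      using that hco_subbaseI(1,2)[of X] by (auto intro: topology_generated_by_Basis)
  qed
  have fell: "openin ?R {f \<in> carrier (PHomeo X). co_dom X f \<in> U}"
    "openin ?R {f \<in> carrier (PHomeo X). co_im X f \<in> U}" if "openin (fell X) U" for U
    using openin_continuous_map_preimage[OF continuous_co_dom_co_im(1) that]
      openin_continuous_map_preimage[OF continuous_co_dom_co_im(2) that] unfolding top .
  have "openin ?R U" if "openin (tau_hco X) U" for U
    using that[unfolded tau_hco_def, THEN openin_topology_generated_by]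
    by (rule generate_topology_on_coarsest[OF istopology_openin, rotated]) (use ico fell in blast)
  moreover have "openin (tau_hco X) U" if "openin ?R U" for U
    using openin_tau_hco_subbase that[THEN openin_topology_generated_by]
    by (rule generate_topology_on_coarsest[OF istopology_openin])
  ultimately show ?thesis by (auto simp: topology_eq)
qed

lemma openin_tau_hco:
  shows "\<And>K V. compactin X K \<Longrightarrow> openin X V \<Longrightarrow> openin (tau_hco X) (ico_set X K V)"
    and "\<And>K V. compactin X K \<Longrightarrow> openin X V \<Longrightarrow> openin (tau_hco X) (ico_set_inv X K V)"
    and "\<And>V. openin X V \<Longrightarrow> openin (tau_hco X) {f \<in> carrier (PHomeo X). \<not> V \<subseteq> ran f}"
  by (rule openin_tau_hco_subbase, rule hco_subbaseI, assumption+)+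

lemma openin_tau_hco_subset_ran:
  assumes K: "compactin X K"
  shows "openin (tau_hco X) {f \<in> carrier (PHomeo X). K \<subseteq> ran f}"
  unfolding subset_ran_eq_ico_set_inv by (rule openin_tau_hco(2)[OF K openin_topspace])

lemma continuous_map_tau_hcoI:
  assumes carr: "\<And>z. z \<in> topspace Z \<Longrightarrow> \<phi> z \<in> carrier (PHomeo X)"
    and ico: "\<And>K V. compactin X K \<Longrightarrow> openin X V \<Longrightarrow>
      openin Z {z \<in> topspace Z. \<phi> z \<in> ico_set X K V}"
    and ico_inv: "\<And>K V. compactin X K \<Longrightarrow> openin X V \<Longrightarrow>
      openin Z {z \<in> topspace Z. \<phi> z \<in> ico_set_inv X K V}"
    and dom: "\<And>V. openin X V \<Longrightarrow> openin Z {z \<in> topspace Z. \<not> V \<subseteq> dom (\<phi> z)}"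
    and ran: "\<And>V. openin X V \<Longrightarrow> openin Z {z \<in> topspace Z. \<not> V \<subseteq> ran (\<phi> z)}"
  shows "continuous_map Z (tau_hco X) \<phi>"
  unfolding tau_hco_eq_generated
proof (rule continuous_on_generated_topo)
  show "\<phi> ` topspace Z \<subseteq> \<Union> (hco_subbase X)"
    unfolding Union_hco_subbase using carr by blast
  have miss: "\<phi> -` {f \<in> carrier (PHomeo X). Q f} \<inter> topspace Z = {z \<in> topspace Z. Q (\<phi> z)}" for Q
    using carr by auto
  have mem: "\<phi> -` P \<inter> topspace Z = {z \<in> topspace Z. \<phi> z \<in> P}" for P by auto
  fix U assume "U \<in> hco_subbase X"
  then show "openin Z (\<phi> -` U \<inter> topspace Z)"
  proof (cases rule: hco_subbase_cases)
    case (ico K V)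
    then show ?thesis using assms(2) by (simp only: mem)
  next
    case (ico_inv K V)
    then show ?thesis using assms(3) by (simp only: mem)
  next
    case (dom V)
    then show ?thesis using assms(4) by (simp only: miss)
  next
    case (ran V)
    then show ?thesis using assms(5) by (simp only: miss)
  qed
qed

text \<open>
  A subbasic condition on \<open>f\<close> either bounds the domain or range from below, and then passes to every
  extension of \<open>f\<close>, or it says that some point is missing, and then it holds eventually.
\<close>

lemma limitin_tau_hco_of_extensions:
  assumes f: "f \<in> carrier (PHomeo X)" and f': "\<forall>\<^sub>F i in F. f' i \<in> carrier (PHomeo X)"
    and ext: "\<forall>\<^sub>F i in F. f \<subseteq>\<^sub>m f' i"
    and dom: "\<And>x. x \<notin> dom f \<Longrightarrow> \<forall>\<^sub>F i in F. x \<notin> dom (f' i)"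
    and ran: "\<And>y. y \<notin> ran f \<Longrightarrow> \<forall>\<^sub>F i in F. y \<notin> ran (f' i)"
  shows "limitin (tau_hco X) f' f F"
  unfolding tau_hco_eq_generated
proof (rule limitin_topology_generated_by)
  show "f \<in> \<Union> (hco_subbase X)" unfolding Union_hco_subbase by (rule f)
  have le: "h x = Some y" if "f \<subseteq>\<^sub>m h" "f x = Some y" for h x y
    using that by (force simp: map_le_def)
  have inj: "x = x'"
    if "h \<in> carrier (PHomeo X)" "h x = Some y" "h x' = Some y" for h x x' y
    using that partial_homeo_inj[of X h] by (simp add: PHomeo_def)
  fix U
  assume "U \<in> hco_subbase X" and fU: "f \<in> U"
  then show "\<forall>\<^sub>F i in F. f' i \<in> U"
  proof (cases rule: hco_subbase_cases)
    case (ico K V)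
    show ?thesis
      using f' ext
    proof eventually_elim
      case (elim i)
      from fU have K: "K \<subseteq> dom f" and V: "\<And>x y. f x = Some y \<Longrightarrow> x \<in> K \<Longrightarrow> y \<in> V"
        unfolding ico ico_set_eq by auto
      have "K \<subseteq> dom (f' i)" using K map_le_implies_dom_le[OF elim(2)] by blast
      moreover have "y \<in> V" if xy: "f' i x = Some y" "x \<in> K" for x y
      proof -
        obtain y' where y': "f x = Some y'" using K xy(2) by blast
        with le[OF elim(2)] xy(1) have "y' = y" by fastforce
        with y' V xy(2) show ?thesis by blast
      qed
      ultimately show ?case using elim(1) unfolding ico ico_set_eq by blast
    qed
  next
    case (ico_inv K V)
    show ?thesis
      using f' ext
    proof eventually_elim
      case (elim i)
      from fU have K: "K \<subseteq> ran f" and V: "\<And>x y. f x = Some y \<Longrightarrow> y \<in> K \<Longrightarrow> x \<in> V"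
        unfolding ico_inv ico_set_inv_eq by auto
      have "K \<subseteq> ran (f' i)" using K le[OF elim(2)] unfolding ran_def by blast
      moreover have "x \<in> V" if xy: "f' i x = Some y" "y \<in> K" for x y
      proof -
        obtain x' where x': "f x' = Some y" using K xy(2) by (auto simp: ran_def)
        then have "x = x'" using inj[OF elim(1) xy(1)] le[OF elim(2)] by blast
        with x' V xy(2) show ?thesis by blast
      qed
      ultimately show ?case using elim(1) unfolding ico_inv ico_set_inv_eq by blast
    qed
  next
    case (dom V)
    then obtain x where x: "x \<in> V" "x \<notin> dom f" using fU by blast
    show ?thesis using f' assms(4)[OF x(2)] by eventually_elim (use x dom in blast)
  next
    case (ran V)
    then obtain y where y: "y \<in> V" "y \<notin> ran f" using fU by blast
    show ?thesis using f' assms(5)[OF y(2)] by eventually_elim (use y ran in blast)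
  qed
qed

text \<open>
  An infinite intersection of open sets, kept open by compactness: near each \<open>a\<close> one compact
  neighbourhood of the point serves for all ranges, and finitely many such \<open>a\<close> suffice.
\<close>

lemma openin_INT_ran_compactin:
  assumes "locally_compact_space X" "Hausdorff_space X"
    and \<phi>: "continuous_map T (tau_hco X) \<phi>" and A: "compactin T A" "A \<noteq> {}"
  shows "openin X (\<Inter>a\<in>A. ran (\<phi> a))"
proof (subst openin_subopen, intro ballI)
  fix y assume y: "y \<in> (\<Inter>a\<in>A. ran (\<phi> a))"
  have \<phi>_carr: "\<phi> a \<in> carrier (PHomeo X)" if "a \<in> topspace T" for a
    using continuous_map_funspace[OF \<phi>] that unfolding topspace_tau_hco by blast
  have AT: "A \<subseteq> topspace T" using A(1) by (rule compactin_subset_topspace)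
  have ran: "openin X (ran (\<phi> a))" if "a \<in> A" for a
    using \<phi>_carr that AT by (auto simp: PHomeo_def partial_homeo_def)
  have nb: "neighbourhood_base_of (compactin X) X"
    using assms(1,2) locally_compact_space_neighbourhood_base by blast
  have "\<exists>U K. openin X U \<and> compactin X K \<and> y \<in> U \<and> U \<subseteq> K \<and> K \<subseteq> ran (\<phi> a)" if "a \<in> A" for a
    using nb ran[OF that] y that unfolding neighbourhood_base_of by (meson INT_E)
  then obtain U K where UK: "\<And>a. a \<in> A \<Longrightarrow>
      openin X (U a) \<and> compactin X (K a) \<and> y \<in> U a \<and> U a \<subseteq> K a \<and> K a \<subseteq> ran (\<phi> a)"
    by metis
  define O' where "O' a = {b \<in> topspace T. \<phi> b \<in> {f \<in> carrier (PHomeo X). K a \<subseteq> ran f}}" for a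
  have O'_open: "openin T (O' a)" if "a \<in> A" for a
    unfolding O'_def
    using openin_continuous_map_preimage[OF \<phi> openin_tau_hco_subset_ran] UK that by blast
  have "a \<in> O' a" if "a \<in> A" for a
    using UK that AT \<phi>_carr unfolding O'_def by blast
  then obtain F where F: "finite F" "F \<subseteq> O' ` A" "A \<subseteq> \<Union>F"
    using compactinD[OF A(1), of "O' ` A"] O'_open by blast
  then obtain B where B: "finite B" "B \<subseteq> A" "A \<subseteq> (\<Union>a\<in>B. O' a)"
    using finite_subset_image by metis
  then have "B \<noteq> {}" using A(2) by auto
  have "openin X (\<Inter>a\<in>B. U a)"
    using B(1,2) \<open>B \<noteq> {}\<close> UK by (intro openin_Inter) auto
  moreover have "y \<in> (\<Inter>a\<in>B. U a)" using UK B(2) by blast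
  moreover have "(\<Inter>a\<in>B. U a) \<subseteq> (\<Inter>a\<in>A. ran (\<phi> a))"
  proof (intro subsetI INT_I)
    fix z a assume z: "z \<in> (\<Inter>a\<in>B. U a)" and "a \<in> A"
    then obtain b where "b \<in> B" "a \<in> O' b" using B(3) by blast
    with z UK B(2) show "z \<in> ran (\<phi> a)" unfolding O'_def by blast
  qed
  ultimately show "\<exists>N. openin X N \<and> y \<in> N \<and> N \<subseteq> (\<Inter>a\<in>A. ran (\<phi> a))" by blast
qed

section \<open>Restricting the range\<close>

text \<open>
  \<open>Some |` E\<close> is the identity on \<open>E\<close>, and \<open>(Some |` E) \<circ>\<^sub>m f\<close> is \<open>f\<close> with its range cut down to \<open>E\<close>.
\<close>

lemma restrict_ran_eq_Some_iff:
  "((Some |` E) \<circ>\<^sub>m f) x = Some y \<longleftrightarrow> f x = Some y \<and> y \<in> E"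
  by (auto simp: map_comp_Some_iff restrict_map_def)

lemma ran_restrict_ran: "ran ((Some |` E) \<circ>\<^sub>m f) = E \<inter> ran f"
  by (auto simp: ran_def restrict_ran_eq_Some_iff)

lemma partial_homeo_restrict_ran:
  assumes f: "partial_homeo X f" and E: "openin X E"
  shows "partial_homeo X ((Some |` E) \<circ>\<^sub>m f)"
proof (rule partial_homeo_map_comp[OF _ f], rule partial_homeoI)
  have pinv_id: "pinv (Some |` E) y = Some y" if "y \<in> E" for y
    using that by (auto simp: pinv_def ran_def restrict_map_def)
  have dom: "dom (Some |` E) = E" and ran: "ran (Some |` E) = E"
    by (auto simp: dom_def ran_def restrict_map_def)
  show "openin X (dom (Some |` E))" "openin X (ran (Some |` E))" unfolding dom ran by (fact E)+
  show "x = x'" if "(Some |` E) x = Some y" "(Some |` E) x' = Some y" for x x' y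
    using that by (auto simp: restrict_map_def split: if_splits)
  have "continuous_map (subtopology X E) X (\<lambda>x. x)"
    by (rule continuous_map_from_subtopology) simp
  then show "continuous_map (subtopology X (dom (Some |` E))) X (the \<circ> (Some |` E))"
    "continuous_map (subtopology X (ran (Some |` E))) X (the \<circ> pinv (Some |` E))"
    unfolding dom ran by (rule continuous_map_eq, simp add: pinv_id)+
qed

lemma comp_pinv_eq_id_ran:
  assumes f: "partial_homeo X f"
  shows "f \<circ>\<^sub>m pinv f = Some |` ran f"
proof
  fix y
  show "(f \<circ>\<^sub>m pinv f) y = (Some |` ran f) y"
  proof (cases "pinv f y")
    case None
    then have "y \<notin> ran f" using dom_pinv[of f] by (metis domIff)
    with None show ?thesis by (simp add: map_comp_def)
  next
    case (Some x)
    then have "f x = Some y" by (simp only: pinv_eq_Some_iff[OF f])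
    with Some show ?thesis by (simp add: map_comp_def ranI)
  qed
qed

lemma idempotent_partial_homeo_fixes:
  assumes f: "partial_homeo X f" and idem: "f \<circ>\<^sub>m f = f" and x: "f x = Some y"
  shows "y = x"
proof -
  have "(f \<circ>\<^sub>m f) x = Some y" using idem x by simp
  then have "f y = Some y" using x by (simp add: map_comp_Some_iff)
  with x partial_homeo_inj[OF f] show ?thesis by blast
qed

section \<open>Extending a continuous premorphism\<close>

locale hco_premorphism =
  fixes G :: "('g, 'n) monoid_scheme" and T :: "'g topology"
    and X :: "'b topology"
    and S :: "('b \<rightharpoonup> 'b) set" and e :: "'b \<rightharpoonup> 'b"
    and \<theta> :: "'g \<Rightarrow> ('b \<rightharpoonup> 'b)"
  assumes tg: "topological_group G T"
    and lc: "locally_compact_space X" and hd: "Hausdorff_space X"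
    and invS: "inverse_subsemigroup S (PHomeo X)" and clS: "closedin (tau_hco X) S"
    and prem: "unital_premorphism G (PHomeo X\<lparr>carrier := S, one := e\<rparr>) \<theta>"
    and cont: "continuous_map T (subtopology (tau_hco X) S) \<theta>"
begin

sublocale group G
  using tg by (simp add: topological_group_def)

lemma topspace_T: "topspace T = carrier G"
  using tg by (simp add: topological_group_def)

lemma continuous_left_quotient:
  "continuous_map (prod_topology T T) T (\<lambda>(a, g). inv\<^bsub>G\<^esub> g \<otimes>\<^bsub>G\<^esub> a)"
proof -
  have mult: "continuous_map (prod_topology T T) T (\<lambda>(x, y). x \<otimes>\<^bsub>G\<^esub> y)"
    and inv: "continuous_map T T (\<lambda>x. inv\<^bsub>G\<^esub> x)"
    using tg by (auto simp: topological_group_def)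
  have "continuous_map (prod_topology T T) (prod_topology T T) (\<lambda>p. (inv\<^bsub>G\<^esub> (snd p), fst p))"
    by (intro continuous_map_pairedI continuous_map_fst
        continuous_map_compose[OF continuous_map_snd inv, unfolded comp_def])
  from continuous_map_compose[OF this mult] show ?thesis
    by (simp add: comp_def case_prod_unfold)
qed

lemma theta_in_S: "g \<in> carrier G \<Longrightarrow> \<theta> g \<in> S"
  using prem by (auto simp: unital_premorphism_def)

lemma S_subset: "S \<subseteq> carrier (PHomeo X)"
  using invS by (simp add: inverse_subsemigroup_def)

lemma comp_in_S: "f \<in> S \<Longrightarrow> h \<in> S \<Longrightarrow> f \<circ>\<^sub>m h \<in> S"
  using invS by (simp add: inverse_subsemigroup_def PHomeo_def)

lemma pinv_in_S: "f \<in> S \<Longrightarrow> pinv f \<in> S"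
  using invS sinv_PHomeo[of f X] S_subset by (fastforce simp: inverse_subsemigroup_def)

lemma partial_homeo_S: "f \<in> S \<Longrightarrow> partial_homeo X f"
  using S_subset by (auto simp: PHomeo_def)

lemma partial_homeo_theta: "g \<in> carrier G \<Longrightarrow> partial_homeo X (\<theta> g)"
  using theta_in_S partial_homeo_S by blast

lemma theta_inv_iff:
  assumes "g \<in> carrier G"
  shows "\<theta> (inv\<^bsub>G\<^esub> g) y = Some x \<longleftrightarrow> \<theta> g x = Some y"
proof -
  have "\<theta> (inv\<^bsub>G\<^esub> g) = pinv (\<theta> g)"
    using prem assms sinv_sub[OF invS theta_in_S, of g] by (simp add: unital_premorphism_def)
  then show ?thesis by (simp add: pinv_eq_Some_iff[OF partial_homeo_theta[OF assms]])
qed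

lemma theta_mult:
  assumes "g \<in> carrier G" "h \<in> carrier G" and h: "\<theta> h x = Some y" and g: "\<theta> g y = Some z"
  shows "\<theta> (g \<otimes>\<^bsub>G\<^esub> h) x = Some z"
proof -
  have "natural_le (PHomeo X\<lparr>carrier := S, one := e\<rparr>) (\<theta> g \<circ>\<^sub>m \<theta> h) (\<theta> (g \<otimes>\<^bsub>G\<^esub> h))"
    using prem assms(1,2) by (simp add: unital_premorphism_def PHomeo_def)
  then obtain i where i: "i \<in> S" "i \<circ>\<^sub>m i = i" "\<theta> g \<circ>\<^sub>m \<theta> h = i \<circ>\<^sub>m \<theta> (g \<otimes>\<^bsub>G\<^esub> h)"
    by (auto simp: natural_le_def PHomeo_def)
  have "(\<theta> g \<circ>\<^sub>m \<theta> h) x = Some z" using g h by (simp add: map_comp_Some_iff)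
  then obtain w where w: "\<theta> (g \<otimes>\<^bsub>G\<^esub> h) x = Some w" "i w = Some z"
    unfolding i(3) by (auto simp: map_comp_Some_iff)
  then have "z = w"
    by (intro idempotent_partial_homeo_fixes[OF partial_homeo_S[OF i(1)] i(2)])
  with w(1) show ?thesis by simp
qed

text \<open>
  The identity of \<open>S\<close> may be the identity on a proper open subset of \<open>X\<close>. This inclusion is why the
  factor \<open>ran (\<theta> 1)\<close> does not cut down \<open>\<theta> g\<close> in the value at \<open>({1, g}, g)\<close>.
\<close>

lemma ran_theta_subset_one:
  assumes g: "g \<in> carrier G"
  shows "ran (\<theta> g) \<subseteq> ran (\<theta> \<one>\<^bsub>G\<^esub>)"
proof
  fix y assume "y \<in> ran (\<theta> g)"
  then obtain x where x: "\<theta> g x = Some y" by (auto simp: ran_def)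
  then have "\<theta> (inv\<^bsub>G\<^esub> g) y = Some x" using theta_inv_iff[OF g] by simp
  then have "\<theta> (g \<otimes>\<^bsub>G\<^esub> inv\<^bsub>G\<^esub> g) y = Some y" using theta_mult g x inv_closed by blast
  then show "y \<in> ran (\<theta> \<one>\<^bsub>G\<^esub>)" using g by (auto simp: ran_def)
qed

text \<open>
  Both directions are instances of \<open>\<theta> g \<theta> h \<le> \<theta> (gh)\<close>: one transports along
  \<open>\<theta> g\<close>, the other along \<open>\<theta> (g\<^sup>-\<^sup>1) = (\<theta> g)\<^sup>-\<^sup>1\<close>.
\<close>

lemma ran_iff_translate:
  assumes g: "g \<in> carrier G" and a: "a \<in> carrier G" and x: "\<theta> g x = Some y"
  shows "y \<in> ran (\<theta> a) \<longleftrightarrow> x \<in> ran (\<theta> (inv\<^bsub>G\<^esub> g \<otimes>\<^bsub>G\<^esub> a))"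
proof
  assume "y \<in> ran (\<theta> a)"
  then obtain w where w: "\<theta> a w = Some y" by (auto simp: ran_def)
  have "\<theta> (inv\<^bsub>G\<^esub> g) y = Some x" using x theta_inv_iff[OF g] by simp
  then have "\<theta> (inv\<^bsub>G\<^esub> g \<otimes>\<^bsub>G\<^esub> a) w = Some x" using theta_mult w g a inv_closed by blast
  then show "x \<in> ran (\<theta> (inv\<^bsub>G\<^esub> g \<otimes>\<^bsub>G\<^esub> a))" by (rule ranI)
next
  assume "x \<in> ran (\<theta> (inv\<^bsub>G\<^esub> g \<otimes>\<^bsub>G\<^esub> a))"
  then obtain w where w: "\<theta> (inv\<^bsub>G\<^esub> g \<otimes>\<^bsub>G\<^esub> a) w = Some x" by (auto simp: ran_def)
  have "\<theta> (g \<otimes>\<^bsub>G\<^esub> (inv\<^bsub>G\<^esub> g \<otimes>\<^bsub>G\<^esub> a)) w = Some y"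
    using theta_mult[OF g _ w x] g a by simp
  then show "y \<in> ran (\<theta> a)" using g a by (auto simp: ran_def m_assoc[symmetric])
qed

definition theta_ext :: "'g set \<times> 'g \<Rightarrow> ('b \<rightharpoonup> 'b)" where
  "theta_ext = (\<lambda>(A, g). (Some |` (\<Inter>a\<in>A. ran (\<theta> a))) \<circ>\<^sub>m \<theta> g)"

lemma theta_ext_eq_Some_iff:
  "theta_ext (A, g) x = Some y \<longleftrightarrow> \<theta> g x = Some y \<and> (\<forall>a\<in>A. y \<in> ran (\<theta> a))"
  by (auto simp: theta_ext_def restrict_ran_eq_Some_iff)

lemma in_expansion_iff:
  "(A, g) \<in> carrier (expansion G T) \<longleftrightarrow>
     compactin T A \<and> g \<in> carrier G \<and> A \<subseteq> carrier G \<and> \<one>\<^bsub>G\<^esub> \<in> A \<and> g \<in> A"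
  using compactin_subset_topspace[of T A] topspace_T by (auto simp: expansion_def)

lemma ran_theta_ext:
  assumes "g \<in> A"
  shows "ran (theta_ext (A, g)) = (\<Inter>a\<in>A. ran (\<theta> a))"
  using assms by (auto simp: theta_ext_def ran_restrict_ran)

lemma dom_theta_ext:
  assumes "(A, g) \<in> carrier (expansion G T)"
  shows "dom (theta_ext (A, g)) = (\<Inter>a\<in>A. ran (\<theta> (inv\<^bsub>G\<^esub> g \<otimes>\<^bsub>G\<^esub> a)))"
proof -
  have A: "A \<subseteq> carrier G" "\<one>\<^bsub>G\<^esub> \<in> A" "g \<in> carrier G"
    using assms by (auto simp: in_expansion_iff)
  have "x \<in> dom (theta_ext (A, g)) \<longleftrightarrow> (\<forall>a\<in>A. x \<in> ran (\<theta> (inv\<^bsub>G\<^esub> g \<otimes>\<^bsub>G\<^esub> a)))" for x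
  proof
    assume "x \<in> dom (theta_ext (A, g))"
    then obtain y where "\<theta> g x = Some y" "\<forall>a\<in>A. y \<in> ran (\<theta> a)"
      by (auto simp: dom_def theta_ext_eq_Some_iff)
    then show "\<forall>a\<in>A. x \<in> ran (\<theta> (inv\<^bsub>G\<^esub> g \<otimes>\<^bsub>G\<^esub> a))"
      using ran_iff_translate A by blast
  next
    assume x: "\<forall>a\<in>A. x \<in> ran (\<theta> (inv\<^bsub>G\<^esub> g \<otimes>\<^bsub>G\<^esub> a))"
    \<comment> \<open>The member \<open>1\<close> of \<open>A\<close> accounts for \<open>x \<in> dom (\<theta> g)\<close>.\<close>
    with A have "x \<in> ran (\<theta> (inv\<^bsub>G\<^esub> g))" by force
    then obtain y where y: "\<theta> g x = Some y" using theta_inv_iff[OF A(3)] by (auto simp: ran_def)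
    then have "\<forall>a\<in>A. y \<in> ran (\<theta> a)" using x ran_iff_translate A by blast
    with y show "x \<in> dom (theta_ext (A, g))" by (auto simp: dom_def theta_ext_eq_Some_iff)
  qed
  then show ?thesis by auto
qed

lemma theta_ext_finite_in_S:
  assumes "finite B" "B \<subseteq> carrier G" "g \<in> carrier G"
  shows "theta_ext (B, g) \<in> S"
  using assms
proof (induction B)
  case empty
  have "theta_ext ({}, g) = \<theta> g"
    by (auto simp: fun_eq_iff theta_ext_def map_comp_def split: option.splits)
  then show ?case using theta_in_S empty by simp
next
  case (insert a B)
  then have a: "a \<in> carrier G" by simp
  have "theta_ext (insert a B, g) = (Some |` ran (\<theta> a)) \<circ>\<^sub>m theta_ext (B, g)"
    by (auto simp: fun_eq_iff theta_ext_def map_comp_def restrict_map_def split: option.splits)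
  also have "\<dots> = (\<theta> a \<circ>\<^sub>m pinv (\<theta> a)) \<circ>\<^sub>m theta_ext (B, g)"
    by (simp add: comp_pinv_eq_id_ran[OF partial_homeo_theta[OF a]])
  also have "\<dots> \<in> S"
    using insert a by (intro comp_in_S pinv_in_S theta_in_S) auto
  finally show ?case .
qed

lemma continuous_theta: "continuous_map T (tau_hco X) \<theta>"
  using cont continuous_map_in_subtopology by blast

lemma theta_ext_in_S:
  assumes "(A, g) \<in> carrier (expansion G T)"
  shows "theta_ext (A, g) \<in> S"
proof -
  have A: "compactin T A" "A \<subseteq> carrier G" "\<one>\<^bsub>G\<^esub> \<in> A" "g \<in> carrier G" "g \<in> A"
    using assms by (auto simp: in_expansion_iff)
  have "openin X (\<Inter>a\<in>A. ran (\<theta> a))"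
    using openin_INT_ran_compactin[OF lc hd continuous_theta A(1)] A(3) by blast
  then have carr: "theta_ext (A, g) \<in> carrier (PHomeo X)"
    using partial_homeo_restrict_ran[OF partial_homeo_theta[OF A(4)]]
    by (simp add: theta_ext_def PHomeo_def)
  let ?F = "finite_subsets_at_top A"
  have fin: "\<forall>\<^sub>F B in ?F. finite B \<and> B \<subseteq> A"
    using eventually_finite_subsets_at_top_weakI by (metis (mono_tags, lifting))
  then have inS: "\<forall>\<^sub>F B in ?F. theta_ext (B, g) \<in> S"
    by eventually_elim (use theta_ext_finite_in_S A in blast)
  \<comment> \<open>A point outside the intersection over \<open>A\<close> misses \<open>ran (\<theta> a)\<close> for one \<open>a\<close>, hence it is outside
    the intersection over every finite subset that contains \<open>a\<close>.\<close>
  have has: "\<forall>\<^sub>F B in ?F. a \<in> B" if "a \<in> A" for a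
    unfolding eventually_finite_subsets_at_top using that by (intro exI[of _ "{a}"]) auto
  have "limitin (tau_hco X) (\<lambda>B. theta_ext (B, g)) (theta_ext (A, g)) ?F"
  proof (rule limitin_tau_hco_of_extensions[OF carr])
    show "\<forall>\<^sub>F B in ?F. theta_ext (B, g) \<in> carrier (PHomeo X)"
      using inS by eventually_elim (use S_subset in blast)
    show "\<forall>\<^sub>F B in ?F. theta_ext (A, g) \<subseteq>\<^sub>m theta_ext (B, g)"
      using fin
    proof eventually_elim
      case (elim B)
      have "theta_ext (B, g) x = Some y" if "theta_ext (A, g) x = Some y" for x y
        using that elim by (auto simp: theta_ext_eq_Some_iff)
      then show ?case by (force simp: map_le_def)
    qed
    show "\<forall>\<^sub>F B in ?F. x \<notin> dom (theta_ext (B, g))" if x: "x \<notin> dom (theta_ext (A, g))" for x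
    proof (cases "\<theta> g x")
      case None
      then have "x \<notin> dom (theta_ext (B, g))" for B by (auto simp: theta_ext_eq_Some_iff)
      then show ?thesis by simp
    next
      case (Some y)
      then obtain a where a: "a \<in> A" "y \<notin> ran (\<theta> a)"
        using x by (auto simp: dom_def theta_ext_eq_Some_iff)
      show ?thesis
        using has[OF a(1)] by eventually_elim (use Some a in \<open>auto simp: theta_ext_eq_Some_iff\<close>)
    qed
    show "\<forall>\<^sub>F B in ?F. y \<notin> ran (theta_ext (B, g))" if y: "y \<notin> ran (theta_ext (A, g))" for y
    proof -
      obtain a where a: "a \<in> A" "y \<notin> ran (\<theta> a)" using y ran_theta_ext[OF A(5)] by auto
      show ?thesis
        using has[OF a(1)]
        by eventually_elim (use a in \<open>auto simp: ran_def theta_ext_eq_Some_iff\<close>)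
    qed
  qed
  from limitin_closedin[OF this clS inS] show ?thesis by simp
qed

text \<open>
  Where \<open>\<theta> g\<close> sends \<open>z\<close> to \<open>y\<close>, the points \<open>z\<close> of \<open>ran (\<theta> b)\<close> correspond to the points \<open>y\<close> of \<open>ran (\<theta> (g b))\<close>; so both
  sides are the restriction of \<open>\<theta> (g h)\<close> with range \<open>E (A \<union> g B)\<close>.
\<close>

lemma theta_ext_mult:
  assumes Ag: "(A, g) \<in> carrier (expansion G T)" and Bh: "(B, h) \<in> carrier (expansion G T)"
  shows "theta_ext (A \<union> (g <#\<^bsub>G\<^esub> B), g \<otimes>\<^bsub>G\<^esub> h) = theta_ext (A, g) \<circ>\<^sub>m theta_ext (B, h)"
proof -
  have A: "A \<subseteq> carrier G" "g \<in> carrier G" "g \<in> A" using Ag by (auto simp: in_expansion_iff)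
  have B: "B \<subseteq> carrier G" "h \<in> carrier G" "h \<in> B" using Bh by (auto simp: in_expansion_iff)
  have gh: "g \<otimes>\<^bsub>G\<^esub> h \<in> carrier G" using A B by simp
  have tr: "y \<in> ran (\<theta> (g \<otimes>\<^bsub>G\<^esub> b)) \<longleftrightarrow> z \<in> ran (\<theta> b)" if "\<theta> g z = Some y" "b \<in> B" for y z b
  proof -
    have "b \<in> carrier G" using that(2) B(1) by blast
    then show ?thesis
      using ran_iff_translate[OF A(2) _ that(1), of "g \<otimes>\<^bsub>G\<^esub> b"] A(2)
      by (simp add: m_assoc[symmetric])
  qed
  have "theta_ext (A \<union> (g <#\<^bsub>G\<^esub> B), g \<otimes>\<^bsub>G\<^esub> h) x = Some y \<longleftrightarrow>
      (theta_ext (A, g) \<circ>\<^sub>m theta_ext (B, h)) x = Some y" (is "?L \<longleftrightarrow> ?R") for x y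
  proof
    assume ?L
    then have xy: "\<theta> (g \<otimes>\<^bsub>G\<^esub> h) x = Some y" and yA: "\<forall>a\<in>A. y \<in> ran (\<theta> a)"
      and yB: "\<forall>b\<in>B. y \<in> ran (\<theta> (g \<otimes>\<^bsub>G\<^esub> b))"
      by (auto simp: theta_ext_eq_Some_iff l_coset_def)
    obtain z where z: "\<theta> g z = Some y" using yA A(3) by (auto simp: ran_def)
    have zB: "\<forall>b\<in>B. z \<in> ran (\<theta> b)" using yB tr[OF z] by blast
    then obtain w where w: "\<theta> h w = Some z" using B(3) by (auto simp: ran_def)
    have "\<theta> (g \<otimes>\<^bsub>G\<^esub> h) w = Some y" using theta_mult A(2) B(2) w z by blast
    then have "w = x" using xy partial_homeo_inj[OF partial_homeo_theta[OF gh]] by blast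
    then show ?R using w z zB yA by (auto simp: map_comp_Some_iff theta_ext_eq_Some_iff)
  next
    assume ?R
    then obtain z where z: "\<theta> h x = Some z" "\<forall>b\<in>B. z \<in> ran (\<theta> b)" "\<theta> g z = Some y"
      "\<forall>a\<in>A. y \<in> ran (\<theta> a)"
      by (auto simp: map_comp_Some_iff theta_ext_eq_Some_iff)
    moreover have "\<theta> (g \<otimes>\<^bsub>G\<^esub> h) x = Some y" using theta_mult A(2) B(2) z by blast
    ultimately show ?L using tr[OF z(3)] by (auto simp: theta_ext_eq_Some_iff l_coset_def)
  qed
  then show ?thesis by (intro ext) (metis not_Some_eq)
qed

lemma theta_ext_hom: "theta_ext \<in> hom (expansion G T) (PHomeo X\<lparr>carrier := S, one := e\<rparr>)"
proof (rule homI)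
  fix p assume p: "p \<in> carrier (expansion G T)"
  show "theta_ext p \<in> carrier (PHomeo X\<lparr>carrier := S, one := e\<rparr>)"
    using theta_ext_in_S p by (cases p) simp
  fix q assume q: "q \<in> carrier (expansion G T)"
  show "theta_ext (p \<otimes>\<^bsub>expansion G T\<^esub> q) =
      theta_ext p \<otimes>\<^bsub>PHomeo X\<lparr>carrier := S, one := e\<rparr>\<^esub> theta_ext q"
    using theta_ext_mult p q by (cases p; cases q) (simp add: expansion_def PHomeo_def)
qed

lemma theta_ext_generator:
  assumes g: "g \<in> carrier G"
  shows "theta_ext ({\<one>\<^bsub>G\<^esub>, g}, g) = \<theta> g"
proof -
  have "theta_ext ({\<one>\<^bsub>G\<^esub>, g}, g) x = Some y \<longleftrightarrow> \<theta> g x = Some y" for x y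
    using ran_theta_subset_one[OF g] by (auto simp: theta_ext_eq_Some_iff intro: ranI)
  then show ?thesis by (intro ext) (metis not_Some_eq)
qed

section \<open>Continuity of the extension\<close>

lemma topspace_expansion: "topspace (expansion_topology G T) = carrier (expansion G T)"
  by (auto simp: expansion_topology_def topspace_vietoris topspace_T in_expansion_iff)

lemma openin_expansion_ball:
  assumes W: "openin (prod_topology T T) W"
  shows "openin (expansion_topology G T) {p \<in> carrier (expansion G T). \<forall>a\<in>fst p. (a, snd p) \<in> W}"
  unfolding expansion_topology_def openin_subtopology
  by (intro exI conjI, rule openin_vietoris_ball[OF W]) (auto simp: in_expansion_iff topspace_T)

lemma openin_expansion_bex:
  assumes W: "openin (prod_topology T T) W"
  shows "openin (expansion_topology G T) {p \<in> carrier (expansion G T). \<exists>a\<in>fst p. (a, snd p) \<in> W}"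
  unfolding expansion_topology_def openin_subtopology
  by (intro exI conjI, rule openin_vietoris_bex[OF W]) (auto simp: in_expansion_iff topspace_T)

lemma openin_ran_theta_pair:
  assumes U: "openin (tau_hco X) {f \<in> carrier (PHomeo X). P (ran f)}"
  shows "openin (prod_topology T T)
      {(a, g). a \<in> carrier G \<and> g \<in> carrier G \<and> P (ran (\<theta> a))}" (is "openin _ ?fst")
    and "openin (prod_topology T T)
      {(a, g). a \<in> carrier G \<and> g \<in> carrier G \<and> P (ran (\<theta> (inv\<^bsub>G\<^esub> g \<otimes>\<^bsub>G\<^esub> a)))}" (is "openin _ ?quot")
proof -
  let ?U = "{f \<in> carrier (PHomeo X). P (ran f)}"
  have carr: "\<theta> a \<in> carrier (PHomeo X)" if "a \<in> carrier G" for a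
    using theta_in_S S_subset that by blast
  have "?fst = {p \<in> topspace (prod_topology T T). (\<theta> \<circ> fst) p \<in> ?U}"
    using carr by (auto simp: topspace_T)
  also have "openin (prod_topology T T) \<dots>"
    by (rule openin_continuous_map_preimage[OF
        continuous_map_compose[OF continuous_map_fst continuous_theta] U])
  finally show "openin (prod_topology T T) ?fst" .
  have "?quot = {p \<in> topspace (prod_topology T T). (\<theta> \<circ> (\<lambda>(a, g). inv\<^bsub>G\<^esub> g \<otimes>\<^bsub>G\<^esub> a)) p \<in> ?U}"
    using carr by (auto simp: topspace_T)
  also have "openin (prod_topology T T) \<dots>"
    by (rule openin_continuous_map_preimage[OF
        continuous_map_compose[OF continuous_left_quotient continuous_theta] U])
  finally show "openin (prod_topology T T) ?quot" .
qed

lemma openin_expansion_snd: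
  assumes U: "openin (tau_hco X) U"
  shows "openin (expansion_topology G T) {p \<in> carrier (expansion G T). \<theta> (snd p) \<in> U}"
proof -
  have "continuous_map (expansion_topology G T) (tau_hco X) (\<theta> \<circ> snd)"
    unfolding expansion_topology_def
    by (intro continuous_map_from_subtopology continuous_map_compose[OF _ continuous_theta]
        continuous_map_snd)
  from openin_continuous_map_preimage[OF this U] show ?thesis
    by (simp add: topspace_expansion)
qed

lemma openin_expansion_ran_theta:
  assumes U: "openin (tau_hco X) {f \<in> carrier (PHomeo X). P (ran f)}"
  shows "openin (expansion_topology G T)
      {p \<in> carrier (expansion G T). \<forall>a\<in>fst p. P (ran (\<theta> a))}"
    and "openin (expansion_topology G T)
      {p \<in> carrier (expansion G T). \<forall>a\<in>fst p. P (ran (\<theta> (inv\<^bsub>G\<^esub> (snd p) \<otimes>\<^bsub>G\<^esub> a)))}"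
    and "openin (expansion_topology G T)
      {p \<in> carrier (expansion G T). \<exists>a\<in>fst p. P (ran (\<theta> a))}"
    and "openin (expansion_topology G T)
      {p \<in> carrier (expansion G T). \<exists>a\<in>fst p. P (ran (\<theta> (inv\<^bsub>G\<^esub> (snd p) \<otimes>\<^bsub>G\<^esub> a)))}"
proof -
  have carr: "a \<in> carrier G \<and> snd p \<in> carrier G" if "p \<in> carrier (expansion G T)" "a \<in> fst p" for p a
    using that by (cases p) (auto simp: in_expansion_iff)
  note pair = openin_ran_theta_pair[OF U]
  show "openin (expansion_topology G T)
      {p \<in> carrier (expansion G T). \<forall>a\<in>fst p. P (ran (\<theta> a))}"
    by (rule back_subst[of "openin _", OF openin_expansion_ball[OF pair(1)]]) (use carr in auto)
  show "openin (expansion_topology G T)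
      {p \<in> carrier (expansion G T). \<forall>a\<in>fst p. P (ran (\<theta> (inv\<^bsub>G\<^esub> (snd p) \<otimes>\<^bsub>G\<^esub> a)))}"
    by (rule back_subst[of "openin _", OF openin_expansion_ball[OF pair(2)]]) (use carr in auto)
  show "openin (expansion_topology G T)
      {p \<in> carrier (expansion G T). \<exists>a\<in>fst p. P (ran (\<theta> a))}"
    by (rule back_subst[of "openin _", OF openin_expansion_bex[OF pair(1)]]) (use carr in auto)
  show "openin (expansion_topology G T)
      {p \<in> carrier (expansion G T). \<exists>a\<in>fst p. P (ran (\<theta> (inv\<^bsub>G\<^esub> (snd p) \<otimes>\<^bsub>G\<^esub> a)))}"
    by (rule back_subst[of "openin _", OF openin_expansion_bex[OF pair(2)]]) (use carr in auto)
qed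

text \<open>
  \<open>theta_ext (A, g)\<close> agrees with \<open>\<theta> g\<close> where it is defined, so a compact-open condition on it splits
  into a condition on its domain or range and the same condition on \<open>\<theta> g\<close>.
\<close>

lemma continuous_theta_ext:
  "continuous_map (expansion_topology G T) (subtopology (tau_hco X) S) theta_ext"
proof -
  let ?C = "carrier (expansion G T)"
  have dom: "dom (theta_ext p) = (\<Inter>a\<in>fst p. ran (\<theta> (inv\<^bsub>G\<^esub> (snd p) \<otimes>\<^bsub>G\<^esub> a)))"
    and ran: "ran (theta_ext p) = (\<Inter>a\<in>fst p. ran (\<theta> a))"
    and inS: "theta_ext p \<in> S" and inS': "\<theta> (snd p) \<in> S"
    and le: "\<And>x y. theta_ext p x = Some y \<Longrightarrow> \<theta> (snd p) x = Some y"
    if p: "p \<in> ?C" for p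
  proof -
    obtain A g where Ag: "p = (A, g)" "(A, g) \<in> ?C" using p by (cases p) blast
    then have "g \<in> A" "g \<in> carrier G" by (simp_all add: in_expansion_iff)
    then show "dom (theta_ext p) = (\<Inter>a\<in>fst p. ran (\<theta> (inv\<^bsub>G\<^esub> (snd p) \<otimes>\<^bsub>G\<^esub> a)))"
      "ran (theta_ext p) = (\<Inter>a\<in>fst p. ran (\<theta> a))" "theta_ext p \<in> S" "\<theta> (snd p) \<in> S"
      "\<And>x y. theta_ext p x = Some y \<Longrightarrow> \<theta> (snd p) x = Some y"
      using dom_theta_ext[OF Ag(2)] ran_theta_ext theta_ext_in_S[OF Ag(2)] theta_in_S
      by (simp_all add: Ag(1) theta_ext_eq_Some_iff)
  qed
  have "continuous_map (expansion_topology G T) (tau_hco X) theta_ext"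
  proof (rule continuous_map_tau_hcoI, unfold topspace_expansion)
    show "theta_ext p \<in> carrier (PHomeo X)" if "p \<in> ?C" for p
      using inS[OF that] S_subset by blast
  next
    fix K V assume KV: "compactin X K" "openin X V"
    have eq: "theta_ext p \<in> ico_set X K V \<longleftrightarrow>
        K \<subseteq> dom (theta_ext p) \<and> \<theta> (snd p) \<in> ico_set X K V" if p: "p \<in> ?C" for p
    proof (cases "K \<subseteq> dom (theta_ext p)")
      case True
      then have "theta_ext p x = \<theta> (snd p) x" if "x \<in> K" for x
        using that le[OF p] by (metis domD subsetD)
      with True show ?thesis
        using S_subset inS[OF p] inS'[OF p] by (auto simp: ico_set_def dom_def)
    qed (simp add: ico_set_def)
    have "{p \<in> ?C. theta_ext p \<in> ico_set X K V} =
        {p \<in> ?C. \<forall>a\<in>fst p. K \<subseteq> ran (\<theta> (inv\<^bsub>G\<^esub> (snd p) \<otimes>\<^bsub>G\<^esub> a))} \<inter>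
        {p \<in> ?C. \<theta> (snd p) \<in> ico_set X K V}"
      using eq by (auto simp: dom)
    then show "openin (expansion_topology G T) {p \<in> ?C. theta_ext p \<in> ico_set X K V}"
      using openin_expansion_ran_theta(2)[OF openin_tau_hco_subset_ran[OF KV(1)]]
        openin_expansion_snd[OF openin_tau_hco(1)[OF KV]] by (simp add: openin_Int)
  next
    fix K V assume KV: "compactin X K" "openin X V"
    have eq: "theta_ext p \<in> ico_set_inv X K V \<longleftrightarrow>
        K \<subseteq> ran (theta_ext p) \<and> \<theta> (snd p) \<in> ico_set_inv X K V" if p: "p \<in> ?C" for p
    proof (cases "K \<subseteq> ran (theta_ext p)")
      case True
      have inj: "x = x'" if "\<theta> (snd p) x = Some y" "\<theta> (snd p) x' = Some y" for x x' y
        using that partial_homeo_inj[OF partial_homeo_S[OF inS'[OF p]]] by blast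
      have "theta_ext p x = Some y \<longleftrightarrow> \<theta> (snd p) x = Some y" if y: "y \<in> K" for x y
      proof
        assume x: "\<theta> (snd p) x = Some y"
        obtain x' where x': "theta_ext p x' = Some y" using True y by (auto simp: ran_def)
        with le[OF p] inj[OF x] have "x = x'" by blast
        with x' show "theta_ext p x = Some y" by simp
      qed (rule le[OF p])
      then have "(\<forall>x y. theta_ext p x = Some y \<longrightarrow> y \<in> K \<longrightarrow> x \<in> V) \<longleftrightarrow>
          (\<forall>x y. \<theta> (snd p) x = Some y \<longrightarrow> y \<in> K \<longrightarrow> x \<in> V)" by metis
      moreover have "K \<subseteq> ran (\<theta> (snd p))" using True le[OF p] unfolding ran_def by blast
      moreover have "theta_ext p \<in> carrier (PHomeo X)" "\<theta> (snd p) \<in> carrier (PHomeo X)"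
        using S_subset inS[OF p] inS'[OF p] by blast+
      ultimately show ?thesis using True by (simp add: ico_set_inv_eq)
    qed (simp add: ico_set_inv_eq)
    have "{p \<in> ?C. theta_ext p \<in> ico_set_inv X K V} =
        {p \<in> ?C. \<forall>a\<in>fst p. K \<subseteq> ran (\<theta> a)} \<inter> {p \<in> ?C. \<theta> (snd p) \<in> ico_set_inv X K V}"
      using eq by (auto simp: ran)
    then show "openin (expansion_topology G T) {p \<in> ?C. theta_ext p \<in> ico_set_inv X K V}"
      using openin_expansion_ran_theta(1)[OF openin_tau_hco_subset_ran[OF KV(1)]]
        openin_expansion_snd[OF openin_tau_hco(2)[OF KV]] by (simp add: openin_Int)
  next
    fix V assume V: "openin X V"
    have "{p \<in> ?C. \<not> V \<subseteq> dom (theta_ext p)} =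
        {p \<in> ?C. \<exists>a\<in>fst p. \<not> V \<subseteq> ran (\<theta> (inv\<^bsub>G\<^esub> (snd p) \<otimes>\<^bsub>G\<^esub> a))}"
      by (simp add: dom le_INF_iff cong: conj_cong)
    then show "openin (expansion_topology G T) {p \<in> ?C. \<not> V \<subseteq> dom (theta_ext p)}"
      using openin_expansion_ran_theta(4)[OF openin_tau_hco(3)[OF V]] by simp
  next
    fix V assume V: "openin X V"
    have "{p \<in> ?C. \<not> V \<subseteq> ran (theta_ext p)} = {p \<in> ?C. \<exists>a\<in>fst p. \<not> V \<subseteq> ran (\<theta> a)}"
      by (simp add: ran le_INF_iff cong: conj_cong)
    then show "openin (expansion_topology G T) {p \<in> ?C. \<not> V \<subseteq> ran (theta_ext p)}"
      using openin_expansion_ran_theta(3)[OF openin_tau_hco(3)[OF V]] by simp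
  qed
  then show ?thesis
    using inS by (auto simp: continuous_map_in_subtopology topspace_expansion)
qed

end

theorem theorem4p17:
  fixes G :: "('g, 'n) monoid_scheme" and T :: "'g topology"
    and X :: "'b topology"
    and S :: "('b \<rightharpoonup> 'b) set" and e :: "'b \<rightharpoonup> 'b"
    and \<theta> :: "'g \<Rightarrow> ('b \<rightharpoonup> 'b)"
  assumes "topological_group G T"
    and "locally_compact_space X" and "Hausdorff_space X"
    and "inverse_subsemigroup S (PHomeo X)" and "closedin (tau_hco X) S"
    and "unital_premorphism G (PHomeo X\<lparr>carrier := S, one := e\<rparr>) \<theta>"
    and "continuous_map T (subtopology (tau_hco X) S) \<theta>"
  shows "\<exists>\<theta>'. \<theta>' \<in> hom (expansion G T) (PHomeo X\<lparr>carrier := S, one := e\<rparr>) \<and>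
           continuous_map (expansion_topology G T) (subtopology (tau_hco X) S) \<theta>' \<and>
           (\<forall>g\<in>carrier G. \<theta>' ({\<one>\<^bsub>G\<^esub>, g}, g) = \<theta> g)"
proof -
  interpret hco_premorphism G T X S e \<theta>
    using assms by unfold_locales
  show ?thesis
    using theta_ext_hom continuous_theta_ext theta_ext_generator by blast
qed

end
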